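(* For all real $x\ge 0$ and integers $k\ge 1$, $$\mathbb{P}(\theta_1<x\,|\,|\mathcal{C}(0)|=k)=1-\left(\cosh\tfrac{x}{2}\right)^{-2k};$$ in particular $$\mathbb{P}(t_\infty<x)=\tanh^2\left(\tfrac{x}{2}\right);$$ and $$\mathbb{P}(\theta_1<x)=\tanh\left(\tfrac{x}{2}\right).$$ Consequently $$\mathbb{E}(\theta_1)=2\log 2\qquad\text{and}\qquad \mathbb{E}(\theta_1\,|\,|\mathcal{C}(0)|=k)=\frac{4^k}{k\binom{2k}{k}}.$$
   Context: For a probability law $\mathcal{W}$ on isomorphism classes of finite rooted simple graphs, let $\mathcal{C}_1^{\mathcal W}(t)$ be the process started at time $0$ from a single root vertex which, when it has $k$ vertices, waits an independent exponential time of rate $k$ and then attaches an independent $\mathcal{W}$-distributed rooted graph $(C,r)$ by adding an edge from $r$ to a uniformly random vertex of the current graph (the root is unchanged). The explosion time $t_\infty$ is the limit of the jump times. If $\mathbb{E}(t_\infty)<\infty$, let $\mathcal{C}^{\mathcal W}(t)$, $t\in\mathbb{R}$, be the stationary process obtained by concatenating independent copies of $\mathcal{C}_1^{\mathcal W}$ on consecutive time intervals (returning to the singleton at each explosion), the copy whose interval contains $0$ being size-biased by its lifetime, with $0$ placed uniformly in that interval. $\mathcal{W}_0$ is the unique law $\mathcal{W}$ such that $\mathcal{C}_1^{\mathcal W}$ explodes almost surely and $\mathcal{C}^{\mathcal W}(0)$ has law $\mathcal{W}$; it is supported on finite rooted trees, and its size distribution is $w_k=\frac{2}{k}\binom{2k-2}{k-1}4^{-k}$,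 with generating function $W(z)=1-\sqrt{1-z}$. Write $\mathcal{C}(t)=\mathcal{C}^{\mathcal{W}_0}(t)$ (the steady state cluster growth process), $\mathcal{C}_1(t)=\mathcal{C}_1^{\mathcal{W}_0}(t)$ with explosion time $t_\infty$, and let $\theta_1$ be the first explosion time of $\mathcal{C}(\cdot)$ after time $0$. $|\cdot|$ denotes the number of vertices. *)

theory Defs
  imports "HOL-Probability.Probability"
begin

section \<open>Isomorphism classes of finite rooted simple graphs\<close>

text \<open>
  A labelled rooted graph is a pair \<open>(n, E)\<close> with vertex set \<open>{0,...,n-1}\<close>, root \<open>0\<close> and edges
  given as two-element sets of vertices. Every finite rooted simple graph is isomorphic to one of
  this form.
\<close>

type_synonym lgraph = "nat \<times> nat set set"

definition is_lgraph :: "lgraph \<Rightarrow> bool" where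
  "is_lgraph G \<longleftrightarrow> 0 < fst G \<and> (\<forall>e\<in>snd G. \<exists>u<fst G. \<exists>v<fst G. u \<noteq> v \<and> e = {u, v})"

definition rooted_iso :: "lgraph \<Rightarrow> lgraph \<Rightarrow> bool" where
  "rooted_iso G H \<longleftrightarrow> is_lgraph G \<and> is_lgraph H \<and>
     (\<exists>f. bij_betw f {..<fst G} {..<fst H} \<and> f 0 = 0 \<and>
        (\<forall>u<fst G. \<forall>v<fst G. {u, v} \<in> snd G \<longleftrightarrow> {f u, f v} \<in> snd H))"

lemma rooted_iso_refl: "is_lgraph G \<Longrightarrow> rooted_iso G G"
  unfolding rooted_iso_def by (intro conjI exI[of _ id]) auto

lemma rooted_iso_sym:
  assumes "rooted_iso G H"
  shows "rooted_iso H G"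
proof -
  from assms obtain f where lg: "is_lgraph G" "is_lgraph H"
    and f: "bij_betw f {..<fst G} {..<fst H}" "f 0 = 0"
      "\<And>u v. u < fst G \<Longrightarrow> v < fst G \<Longrightarrow> {u, v} \<in> snd G \<longleftrightarrow> {f u, f v} \<in> snd H"
    unfolding rooted_iso_def by blast
  define g where "g = the_inv_into {..<fst G} f"
  have g: "bij_betw g {..<fst H} {..<fst G}"
    unfolding g_def using f(1) by (rule bij_betw_the_inv_into)
  have fg: "f (g v) = v" if "v < fst H" for v
    unfolding g_def using that f(1) by (intro f_the_inv_into_f) (auto simp: bij_betw_def)
  have g_lt: "g v < fst G" if "v < fst H" for v
    using bij_betwE[OF g] that by auto
  have "g 0 = 0"
    unfolding g_def using f(1,2) lg(1)
    by (intro the_inv_into_f_eq) (auto simp: bij_betw_def is_lgraph_def)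
  moreover have "{u, v} \<in> snd H \<longleftrightarrow> {g u, g v} \<in> snd G" if "u < fst H" "v < fst H" for u v
    using f(3)[OF g_lt[OF that(1)] g_lt[OF that(2)]] that by (simp add: fg)
  ultimately show ?thesis
    unfolding rooted_iso_def using lg g by blast
qed

lemma rooted_iso_trans:
  assumes "rooted_iso G H" "rooted_iso H K"
  shows "rooted_iso G K"
proof -
  from assms(1) obtain f where lg: "is_lgraph G"
    and f: "bij_betw f {..<fst G} {..<fst H}" "f 0 = 0"
      "\<And>u v. u < fst G \<Longrightarrow> v < fst G \<Longrightarrow> {u, v} \<in> snd G \<longleftrightarrow> {f u, f v} \<in> snd H"
    unfolding rooted_iso_def by blast
  from assms(2) obtain g where lk: "is_lgraph K"
    and g: "bij_betw g {..<fst H} {..<fst K}" "g 0 = 0"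
      "\<And>u v. u < fst H \<Longrightarrow> v < fst H \<Longrightarrow> {u, v} \<in> snd H \<longleftrightarrow> {g u, g v} \<in> snd K"
    unfolding rooted_iso_def by blast
  have f_lt: "f v < fst H" if "v < fst G" for v
    using bij_betwE[OF f(1)] that by auto
  show ?thesis
    unfolding rooted_iso_def
  proof (intro conjI exI[of _ "g \<circ> f"] allI impI)
    show "bij_betw (g \<circ> f) {..<fst G} {..<fst K}"
      using f(1) g(1) by (rule bij_betw_trans)
  qed (use lg lk f(2,3) g(2,3) f_lt in simp_all)
qed

lemma is_lgraph_singleton: "is_lgraph (1, {})"
  by (simp add: is_lgraph_def)

quotient_type rgraph = lgraph / partial: rooted_iso
proof (rule part_equivpI)
  show "\<exists>G. rooted_iso G G"
    using rooted_iso_refl[OF is_lgraph_singleton] by blast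
  show "symp rooted_iso"
    by (rule sympI) (rule rooted_iso_sym)
  show "transp rooted_iso"
    by (rule transpI) (rule rooted_iso_trans)
qed

lift_definition num_vertices :: "rgraph \<Rightarrow> nat" is fst
  by (auto simp: rooted_iso_def dest: bij_betw_same_card)


section \<open>The growth process from a single vertex\<close>

text \<open>
  \<open>attach G v H\<close> is the disjoint union of \<open>G\<close> and \<open>H\<close> with an additional edge between \<open>v\<close> (in \<open>G\<close>)
  and the root of \<open>H\<close>; vertex \<open>i\<close> of \<open>H\<close> is relabelled \<open>fst G + i\<close>, and the root remains that of \<open>G\<close>.
\<close>

definition attach :: "lgraph \<Rightarrow> nat \<Rightarrow> lgraph \<Rightarrow> lgraph" where
  "attach G v H =
     (fst G + fst H, snd G \<union> (\<lambda>e. (+) (fst G) ` e) ` snd H \<union> {{v, fst G}})"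

text \<open>
  The process is driven by independent steps \<open>(e, H, u)\<close>, with \<open>e\<close> exponential of rate \<open>1\<close>, \<open>H\<close> of
  law \<open>W\<close> and \<open>u\<close> uniform on \<open>[0,1)\<close>. With \<open>k\<close> vertices present, the waiting time \<open>e / k\<close> is
  exponential of rate \<open>k\<close>, and \<open>\<lfloor>u k\<rfloor>\<close> is uniform on the vertex set \<open>{0,...,k-1}\<close>. Since that vertex
  is uniform, the choice of the representative of \<open>H\<close> does not affect the law of the process of
  isomorphism classes. A law on the countable type of isomorphism classes is a \<open>pmf\<close>.
\<close>

type_synonym step = "real \<times> rgraph \<times> real"

definition step_law :: "rgraph pmf \<Rightarrow> step measure" where
  "step_law W = density lborel (exponential_density 1) \<Otimes>\<^sub>M
     (measure_pmf W \<Otimes>\<^sub>M uniform_measure lborel {0..<1})"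

definition growth_law :: "rgraph pmf \<Rightarrow> (nat \<Rightarrow> step) measure" where
  "growth_law W = (\<Pi>\<^sub>M n\<in>UNIV. step_law W)"

primrec jump_state :: "(nat \<Rightarrow> step) \<Rightarrow> nat \<Rightarrow> lgraph" where
  "jump_state \<omega> 0 = (1, {})"
| "jump_state \<omega> (Suc n) =
     (let G = jump_state \<omega> n; (_, H, u) = \<omega> n
      in attach G (nat \<lfloor>u * real (fst G)\<rfloor>) (rep_rgraph H))"

definition jump_time :: "(nat \<Rightarrow> step) \<Rightarrow> nat \<Rightarrow> real" where
  "jump_time \<omega> n = (\<Sum>i<n. fst (\<omega> i) / real (fst (jump_state \<omega> i)))"

definition explosion_time :: "(nat \<Rightarrow> step) \<Rightarrow> ennreal" where
  "explosion_time \<omega> = (SUP n. ennreal (jump_time \<omega> n))"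

text \<open>Only meaningful for \<open>0 \<le> t\<close> before the explosion time.\<close>

definition growth_process :: "(nat \<Rightarrow> step) \<Rightarrow> real \<Rightarrow> rgraph" where
  "growth_process \<omega> t = abs_rgraph (jump_state \<omega> (LEAST n. t < jump_time \<omega> (Suc n)))"


section \<open>The stationary process\<close>

text \<open>
  A sample is a pair \<open>(u, X)\<close>: the copies \<open>X i\<close>, \<open>i \<in> \<int>\<close>, are placed on consecutive intervals, where
  \<open>X 0\<close> is size-biased by its lifetime and \<open>0\<close> is located at the fraction \<open>u\<close> of its interval.
\<close>

definition size_biased_law :: "rgraph pmf \<Rightarrow> (nat \<Rightarrow> step) measure" where
  "size_biased_law W = density (growth_law W)
     (\<lambda>\<omega>. explosion_time \<omega> / (\<integral>\<^sup>+ \<omega>'. explosion_time \<omega>' \<partial>growth_law W))"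

type_synonym sample = "real \<times> (int \<Rightarrow> nat \<Rightarrow> step)"

definition stationary_law :: "rgraph pmf \<Rightarrow> sample measure" where
  "stationary_law W = uniform_measure lborel {0..<1} \<Otimes>\<^sub>M
     (\<Pi>\<^sub>M i\<in>UNIV. if i = 0 then size_biased_law W else growth_law W)"

definition lifetime :: "sample \<Rightarrow> int \<Rightarrow> real" where
  "lifetime \<omega> i = enn2real (explosion_time (snd \<omega> i))"

text \<open>Copy \<open>i\<close> occupies the interval from \<open>start_time \<omega> i\<close> to \<open>start_time \<omega> (i + 1)\<close>.\<close>

definition start_time :: "sample \<Rightarrow> int \<Rightarrow> real" where
  "start_time \<omega> i = - fst \<omega> * lifetime \<omega> 0 +
     (if 0 \<le> i then \<Sum>j\<in>{0..<i}. lifetime \<omega> j else - (\<Sum>j\<in>{i..<0}. lifetime \<omega> j))"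

definition stationary_process :: "sample \<Rightarrow> real \<Rightarrow> rgraph" where
  "stationary_process \<omega> t =
     (let i = THE i. start_time \<omega> i \<le> t \<and> t < start_time \<omega> (i + 1)
      in growth_process (snd \<omega> i) (t - start_time \<omega> i))"

definition first_explosion :: "sample \<Rightarrow> real" where
  "first_explosion \<omega> = Inf {start_time \<omega> i | i. 0 < start_time \<omega> i}"

text \<open>
  The finiteness of the expected explosion time is what makes the stationary process well defined.
\<close>

definition steady_state_law :: "rgraph pmf \<Rightarrow> bool" where
  "steady_state_law W \<longleftrightarrow>
     (AE \<omega> in growth_law W. explosion_time \<omega> < \<infinity>) \<and>
     (\<integral>\<^sup>+ \<omega>. explosion_time \<omega> \<partial>growth_law W) < \<infinity> \<and>
     distr (stationary_law W) (count_space UNIV) (\<lambda>\<omega>. stationary_process \<omega> 0) = measure_pmf W"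

end

theory Submission
  imports Defs "HOL-Real_Asymp.Real_Asymp"
begin

text \<open>
  Only cluster sizes matter: a cluster of size \<open>a\<close> waits an exponential time of rate \<open>a\<close> and then
  grows by an independent increment with weights \<open>w k\<close>, the probabilities of size \<open>k\<close> under \<open>W\<close>.
  Let \<open>T a\<close> be the explosion time from size \<open>a\<close>, let \<open>m\<close> be the mean of \<open>T 1\<close>, and write
  \<open>G a x = 1 / cosh (x / 2) ^ (2 * a)\<close>. The heart of the matter is \<open>P(T a \<ge> x) = G a x\<close>.

  Stationarity and the Markov property. At time \<open>0\<close> the observer sits at a uniform position in a
  size-biased copy, so expectations are \<open>1 / m\<close> times integrals along one copy of the growth process.
  A visit to size \<open>k\<close> lasts for a mean time of \<open>1 / k\<close>, and the lifetime left at a typical time of it is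
  distributed as \<open>T k\<close>, independently of the past (\<open>expected_occupation\<close>). Hence
  \<open>P(size = k) = U (k - 1) / (m k)\<close>, with \<open>U\<close> the renewal probabilities of the increments, and, given
  size \<open>k\<close>, the residual time \<open>\<theta>\<close> is distributed as \<open>T k\<close> (\<open>conditioned_integral\<close>).

  The weights. In a steady state the first of these probabilities equals \<open>w k\<close>. For the generating
  function \<open>V\<close> of \<open>w\<close> this says \<open>V' (1 - V) = 1 / m\<close>, thus \<open>(1 - V)\<^sup>2 = 1 - 2 z / m\<close>; since the
  weights sum to \<open>1\<close>, \<open>m = 2\<close> and \<open>V(z) = 1 - sqrt (1 - z)\<close> (\<open>generating_function\<close>).

  The upper bound. With this \<open>V\<close>, the functions \<open>G a\<close> solve the backward equation of the
  probabilities \<open>P(T a > x)\<close>. These are the minimal nonnegative solution, being the limit of the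
  corresponding probabilities for the \<open>n\<close>-th jump time, so \<open>P(T a \<ge> x) \<le> G a x\<close>
  (\<open>explosion_from_tail_bound\<close>).

  Equality. The mean \<open>m = 2\<close> forces the bound to be sharp. By residual life in a stationary renewal process,
  \<open>\<Sum>k. w k * P(T k \<ge> x) = P(\<theta> \<ge> x)\<close> is half the integral of \<open>P(T 1 \<ge> y)\<close> over \<open>y \<ge> x\<close>. The full
  integral is \<open>2\<close>, and over \<open>y < x\<close> it is at most the integral \<open>2 tanh (x / 2)\<close> of \<open>G 1\<close>. So the sum is
  at least \<open>1 - tanh (x / 2)\<close>, which is precisely \<open>\<Sum>k. w k * G k x\<close>. As all weights are positive, each
  bound must be an equality (\<open>survival_eq\<close>). The unconditional law of \<open>\<theta>\<close> follows by averaging over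
  the size, and the means by integrating the tails.
\<close>

section \<open>Powers of the hyperbolic secant\<close>

lemma inverse_cosh_squared: "1 / cosh x ^ 2 = 1 - tanh x ^ 2" for x :: real
proof -
  have "1 / cosh x ^ 2 = (cosh x ^ 2 - sinh x ^ 2) / cosh x ^ 2"
    by (simp add: hyperbolic_pythagoras)
  then show ?thesis by (simp add: tanh_def diff_divide_distrib power_divide)
qed

lemma has_derivative_sech_power:
  "((\<lambda>x. 1 / cosh (x / 2) ^ (2 * k)) has_real_derivative
     - (real k * tanh (x / 2) / cosh (x / 2) ^ (2 * k))) (at x)"
proof (cases "k = 0")
  case False
  have "((\<lambda>x::real. 1 / cosh (x / 2)) has_real_derivative - (tanh (x / 2) / 2) * (1 / cosh (x / 2))) (at x)"
    by (auto intro!: derivative_eq_intros simp: tanh_def)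
  from DERIV_power[OF this, of "2 * k"] False show ?thesis
    by (simp add: power_one_over mult.assoc flip: power_Suc)
qed simp

lemma has_derivative_tanh_half:
  "((\<lambda>x. 2 * tanh (x / 2)) has_real_derivative 1 / cosh (x / 2) ^ 2) (at x)"
  by (auto intro!: derivative_eq_intros simp: inverse_cosh_squared)

lemma tanh_half_limit: "((\<lambda>x::real. tanh (x / 2)) \<longlongrightarrow> 1) at_top"
  by (rule filterlim_compose[OF tanh_real_at_top]) real_asymp

lemma sech_power_limit:
  assumes "0 < k" shows "((\<lambda>x::real. 1 / cosh (x / 2) ^ (2 * k)) \<longlongrightarrow> 0) at_top"
proof -
  have "((\<lambda>x::real. (1 - tanh (x / 2) ^ 2) ^ k) \<longlongrightarrow> (1 - 1 ^ 2) ^ k) at_top"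
    by (intro tendsto_intros tanh_half_limit)
  then show ?thesis using assms
    by (simp add: inverse_cosh_squared[symmetric] power_mult power_one_over zero_power)
qed

text \<open>
  The derivative of \<open>tanh * sech ^ (2k)\<close> combines the powers \<open>2k\<close> and \<open>2k + 2\<close> of the secant, which
  expresses an antiderivative of the higher power by one of the lower. At infinity the product
  vanishes, so the integrals obey the recurrence \<open>I (k + 1) = 2k / (2k + 1) * I k\<close>.
\<close>
lemma sech_power_antiderivative:
  assumes "0 < k"
  shows "\<exists>F. (\<forall>x. (F has_real_derivative 1 / cosh (x / 2) ^ (2 * k)) (at x)) \<and> F 0 = 0 \<and>
           (F \<longlongrightarrow> 4 ^ k / (real k * real ((2 * k) choose k))) at_top"
  using assms
proof (induction k rule: nat_induct_non_zero)
  case 1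
  have "((\<lambda>x::real. 2 * tanh (x / 2)) \<longlongrightarrow> 2 * 1) at_top"
    by (intro tendsto_intros tanh_half_limit)
  then show ?case
    by (intro exI[of _ "\<lambda>x. 2 * tanh (x / 2)"]) (auto simp: has_derivative_tanh_half)
next
  case (Suc k)
  then obtain F where F: "\<And>x. (F has_real_derivative 1 / cosh (x / 2) ^ (2 * k)) (at x)" "F 0 = 0"
    "(F \<longlongrightarrow> 4 ^ k / (real k * real ((2 * k) choose k))) at_top" by blast
  define H where
    "H x = (2 * tanh (x / 2) * (1 / cosh (x / 2) ^ (2 * k)) + 2 * real k * F x) / (2 * real k + 1)" for x
  have "(H has_real_derivative 1 / cosh (x / 2) ^ (2 * Suc k)) (at x)" for x
  proof -
    let ?G = "1 / cosh (x / 2) ^ (2 * k)" and ?t = "tanh (x / 2)"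
    have "(H has_real_derivative
        ((1 / cosh (x / 2) ^ 2) * ?G + - (real k * ?t / cosh (x / 2) ^ (2 * k)) * (2 * ?t)
          + 2 * real k * ?G) / (2 * real k + 1)) (at x)"
      unfolding H_def
      by (intro DERIV_cdivide DERIV_add DERIV_mult DERIV_cmult has_derivative_tanh_half
          has_derivative_sech_power F)
    also have "((1 / cosh (x / 2) ^ 2) * ?G + - (real k * ?t / cosh (x / 2) ^ (2 * k)) * (2 * ?t)
          + 2 * real k * ?G) / (2 * real k + 1) = (1 - ?t ^ 2) * ?G"
      unfolding inverse_cosh_squared by (simp add: divide_simps) (simp add: algebra_simps power2_eq_square)
    also have "\<dots> = 1 / cosh (x / 2) ^ (2 * Suc k)"
      unfolding inverse_cosh_squared[symmetric] by (simp add: power_add power2_eq_square)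
    finally show ?thesis .
  qed
  moreover have "H 0 = 0" by (simp add: H_def F)
  moreover have "(H \<longlongrightarrow> 4 ^ Suc k / (real (Suc k) * real ((2 * Suc k) choose Suc k))) at_top"
  proof -
    have "(H \<longlongrightarrow> (2 * 1 * 0 + 2 * real k * (4 ^ k / (real k * real ((2 * k) choose k)))) / (2 * real k + 1)) at_top"
      unfolding H_def
      by (intro tendsto_intros F sech_power_limit[OF Suc(1)] tanh_half_limit) auto
    also have "Suc k * ((2 * Suc k) choose Suc k) = 2 * (2 * k + 1) * ((2 * k) choose k)"
    proof -
      have "Suc k * ((2 * Suc k) choose Suc k) = 2 * (Suc k * (Suc (2 * k) choose k))"
        using Suc_times_binomial_eq[of "Suc (2 * k)" k]
        by (simp add: mult.commute del: binomial_Suc_Suc)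
      also have "Suc (2 * k) choose k = Suc (2 * k) choose Suc k"
        using binomial_symmetric[of k "Suc (2 * k)"] by simp
      also have "Suc k * (Suc (2 * k) choose Suc k) = Suc (2 * k) * (2 * k choose k)"
        using Suc_times_binomial_eq[of "2 * k" k] by (simp add: mult.commute del: binomial_Suc_Suc)
      finally show ?thesis by simp
    qed
    then have "real (Suc k) * real ((2 * Suc k) choose Suc k) = 2 * (2 * real k + 1) * real ((2 * k) choose k)"
      by (metis (mono_tags, lifting) of_nat_1 of_nat_add of_nat_mult of_nat_numeral)
    then have "(2 * 1 * 0 + 2 * real k * (4 ^ k / (real k * real ((2 * k) choose k)))) / (2 * real k + 1)
       = 4 ^ Suc k / (real (Suc k) * real ((2 * Suc k) choose Suc k))"
    proof -
      have "2 * real k + 1 \<noteq> 0" "0 < ((2 * k) choose k)" by auto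
      with Suc(1) show ?thesis unfolding \<open>real (Suc k) * _ = _\<close>
        by (simp add: divide_simps del: binomial_eq_0_iff zero_less_binomial_iff)
    qed
    finally show ?thesis .
  qed
  ultimately show ?case by blast
qed

lemma nn_integral_sech_power:
  assumes "0 < k"
  shows "(\<integral>\<^sup>+ x. ennreal (1 / cosh (x / 2) ^ (2 * k)) * indicator {0..} x \<partial>lborel)
    = ennreal (4 ^ k / (real k * real ((2 * k) choose k)))"
proof -
  from sech_power_antiderivative[OF assms] obtain F where
    F: "\<And>x. (F has_real_derivative 1 / cosh (x / 2) ^ (2 * k)) (at x)" "F 0 = 0"
    "(F \<longlongrightarrow> 4 ^ k / (real k * real ((2 * k) choose k))) at_top" by blast
  have "continuous_on UNIV (\<lambda>x::real. 1 / cosh (x / 2) ^ (2 * k))"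
    by (intro continuous_intros) auto
  then have "(\<lambda>x::real. 1 / cosh (x / 2) ^ (2 * k)) \<in> borel_measurable borel"
    by (rule borel_measurable_continuous_onI)
  from nn_integral_FTC_atLeast[OF this F(1) _ F(3), of 0] show ?thesis
    by (simp add: F(2))
qed

lemma nn_integral_sech_squared_Icc:
  assumes "0 \<le> x"
  shows "(\<integral>\<^sup>+ y. ennreal (1 / cosh (y / 2) ^ 2) * indicator {0..x} y \<partial>lborel) = ennreal (2 * tanh (x / 2))"
proof -
  have "continuous_on UNIV (\<lambda>x::real. 1 / cosh (x / 2) ^ 2)"
    by (intro continuous_intros) auto
  then have "(\<lambda>x::real. 1 / cosh (x / 2) ^ 2) \<in> borel_measurable borel"
    by (rule borel_measurable_continuous_onI)
  from nn_integral_FTC_Icc[OF this has_derivative_tanh_half[THEN has_field_derivative_at_within] _ assms]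
  show ?thesis by simp
qed

lemma nn_integral_one_minus_tanh:
  "(\<integral>\<^sup>+ x. ennreal (1 - tanh (x / 2)) * indicator {0..} x \<partial>lborel) = ennreal (2 * ln 2)"
proof -
  have "((\<lambda>x::real. x - 2 * ln (cosh (x / 2))) \<longlongrightarrow> - (2 * ln (1 / 2))) at_top"
    unfolding cosh_def scaleR_conv_of_real of_real_eq_id id_def by real_asymp
  moreover have "ln (1 / 2) = - ln (2 :: real)" by (subst ln_div) auto
  ultimately have "((\<lambda>x::real. x - 2 * ln (cosh (x / 2))) \<longlongrightarrow> 2 * ln 2) at_top" by simp
  moreover have "((\<lambda>x::real. x - 2 * ln (cosh (x / 2))) has_real_derivative 1 - tanh (x / 2)) (at x)" for x
    by (auto intro!: derivative_eq_intros simp: tanh_def)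
  moreover have "(\<lambda>x::real. 1 - tanh (x / 2)) \<in> borel_measurable borel"
    by (intro borel_measurable_continuous_onI continuous_intros) auto
  ultimately have "(\<integral>\<^sup>+ x. ennreal (1 - tanh (x / 2)) * indicator {0..} x \<partial>lborel)
     = ennreal (2 * ln 2 - (0 - 2 * ln (cosh (0 / 2))))"
    by (intro nn_integral_FTC_atLeast) (auto intro: less_imp_le tanh_real_lt_1)
  then show ?thesis by simp
qed

text \<open>
  The integrand is the derivative of \<open>- exp (- k r) G(x - r)\<close>, \<open>G\<close> being the power of the secant. The
  factor \<open>1 - tanh\<close> will arise as the generating function \<open>1 - sqrt (1 - z)\<close> at \<open>z = sech\<^sup>2\<close>, so that
  this is the first-step equation for a cluster of size \<open>k\<close>, restricted to first jumps before time \<open>x\<close>.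
\<close>
lemma sech_power_backward_equation:
  assumes "0 \<le> x"
  shows "(\<integral>\<^sup>+ r. ennreal (real k * exp (- real k * r) * ((1 / cosh ((x - r) / 2) ^ (2 * k)) * (1 - tanh ((x - r) / 2))))
           * indicator {0..x} r \<partial>lborel)
    = ennreal (1 / cosh (x / 2) ^ (2 * k) - exp (- real k * x))"
proof -
  let ?f = "\<lambda>r. real k * exp (- real k * r) * ((1 / cosh ((x - r) / 2) ^ (2 * k)) * (1 - tanh ((x - r) / 2)))"
  let ?F = "\<lambda>r. - (exp (- real k * r) * (1 / cosh ((x - r) / 2) ^ (2 * k)))"
  have "(?F has_real_derivative ?f r) (at r)" for r
  proof -
    have "((\<lambda>r. 1 / cosh ((x - r) / 2) ^ (2 * k)) has_real_derivative
        - (real k * tanh ((x - r) / 2) / cosh ((x - r) / 2) ^ (2 * k)) * (-1)) (at r)"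
      by (rule DERIV_chain2[where f="\<lambda>y. 1 / cosh (y / 2) ^ (2 * k)" and g="\<lambda>r. x - r"])
         (rule has_derivative_sech_power, auto intro!: derivative_eq_intros)
    note D = DERIV_minus[OF DERIV_mult[OF _ this]]
    show ?thesis
      by (rule D[THEN DERIV_cong]) (auto intro!: derivative_eq_intros simp: field_simps)
  qed
  moreover have "?f \<in> borel_measurable borel"
    by (intro borel_measurable_continuous_onI continuous_intros) auto
  ultimately have "(\<integral>\<^sup>+ r. ennreal (?f r) * indicator {0..x} r \<partial>lborel) = ennreal (?F x - ?F 0)"
    using assms
    by (intro nn_integral_FTC_Icc) (auto intro!: mult_nonneg_nonneg divide_nonneg_nonneg has_field_derivative_at_within less_imp_le[OF tanh_real_lt_1])
  then show ?thesis by simp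
qed

section \<open>Weights determined by the renewal equation\<close>

text \<open>
  The sum in the last assumption is the probability that a random walk with step weights \<open>w\<close> started
  at \<open>0\<close> ever visits \<open>k\<close>; as \<open>w 0 = 0\<close>, it cannot do so after more than \<open>k\<close> steps. The number \<open>m\<close> is
  not prescribed: it comes out as \<open>2\<close>.
\<close>
locale self_consistent_weights =
  fixes w :: "nat \<Rightarrow> real" and m :: real
  assumes weight_nonneg: "\<And>k. 0 \<le> w k"
    and weight_0: "w 0 = 0"
    and weights_sum: "w sums 1"
    and m_pos: "0 < m"
    and renewal: "\<And>k. m * (real (Suc k) * w (Suc k)) = (\<Sum>n\<le>k. fps_nth (Abs_fps w ^ n) k)"
begin

text \<open>
  The renewal probabilities have generating function \<open>1 / (1 - V)\<close>, by summing the geometric series.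
\<close>
lemma renewal_fps:
  "fps_deriv (Abs_fps w) * (1 - Abs_fps w) = fps_const (1 / m)"
proof -
  let ?V = "Abs_fps w"
  \<comment> \<open>Higher powers of the series do not reach the coefficient \<open>d\<close>, so any later truncation will do.\<close>
  define U where "U = Abs_fps (\<lambda>d. \<Sum>n\<le>d. fps_nth (?V ^ n) d)"
  have U_nth: "fps_nth U d = fps_nth (\<Sum>n\<le>N. ?V ^ n) d" if "d \<le> N" for d N
  proof -
    have "(\<Sum>n\<le>N. fps_nth (?V ^ n) d) = (\<Sum>n\<le>d. fps_nth (?V ^ n) d)"
      using that startsby_zero_power_prefix[of ?V] weight_0
      by (intro sum.mono_neutral_right) auto
    then show ?thesis by (simp add: U_def fps_sum_nth)
  qed
  have "U * (1 - ?V) = 1"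
  proof (rule fps_ext)
    fix d
    have "fps_nth (U * (1 - ?V)) d = fps_nth ((\<Sum>n\<le>d. ?V ^ n) * (1 - ?V)) d"
      unfolding fps_mult_nth by (intro sum.cong refl arg_cong2[where f="(*)"] U_nth) auto
    also have "(\<Sum>n\<le>d. ?V ^ n) * (1 - ?V) = 1 - ?V ^ Suc d"
      using sum_gp_basic[of ?V d] by (simp add: mult.commute)
    also have "fps_nth \<dots> d = fps_nth 1 d"
      using startsby_zero_power_prefix[of ?V "Suc d"] weight_0 by simp
    finally show "fps_nth (U * (1 - ?V)) d = fps_nth 1 d" .
  qed
  moreover have "fps_deriv ?V = fps_const (1 / m) * U"
    using m_pos by (intro fps_ext) (simp add: U_def field_simps renewal[symmetric])
  ultimately show ?thesis by (simp add: mult.assoc)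
qed

lemma one_minus_weights_squared:
  "(1 - Abs_fps w) ^ 2 = 1 - fps_const (2 / m) * fps_X"
proof -
  have "fps_deriv ((1 - Abs_fps w) ^ 2) = - 2 * (fps_deriv (Abs_fps w) * (1 - Abs_fps w))"
    by (simp add: power2_eq_square algebra_simps)
  also have "\<dots> = fps_deriv (1 - fps_const (2 / m) * fps_X)"
    unfolding renewal_fps by (rule fps_ext) (simp add: numeral_fps_const)
  finally show ?thesis
    by (subst (asm) fps_deriv_eq_iff) (simp add: weight_0 power2_eq_square)
qed

lemma weights_power_summable:
  assumes "0 \<le> z" "z \<le> 1" shows "summable (\<lambda>k. w k * z ^ k)"
proof (rule summable_comparison_test'[OF sums_summable[OF weights_sum]])
  show "norm (w k * z ^ k) \<le> w k" for k
    using assms weight_nonneg[of k] by (simp add: abs_mult mult_left_le power_le_one)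
qed

text \<open>
  Absolute convergence holds up to \<open>z = 1\<close>, so the identity of formal series may be evaluated on the
  closed interval. The endpoint is what determines \<open>m\<close>.
\<close>
lemma generating_function_squared:
  assumes z: "0 \<le> z" "z \<le> 1"
  shows "(1 - (\<Sum>k. w k * z ^ k)) ^ 2 = 1 - 2 / m * z"
proof -
  define c where "c k = fps_nth (1 - Abs_fps w) k * z ^ k" for k
  have c: "c = (\<lambda>k. (if k = 0 then 1 else 0) - w k * z ^ k)"
    by (auto simp: c_def fun_eq_iff algebra_simps)
  have c_sums: "c sums (1 - (\<Sum>k. w k * z ^ k))"
    unfolding c by (intro sums_diff summable_sums weights_power_summable z)
      (use sums_single[of 0 "\<lambda>_. 1::real"] in simp)
  have "norm (c k) = (if k = 0 then 1 else 0) + w k * z ^ k" for k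
    using z weight_nonneg[of k] by (auto simp: c weight_0 abs_mult)
  moreover have "summable (\<lambda>k. (if k = 0 then 1 else 0) + w k * z ^ k)"
    by (intro summable_add weights_power_summable z) (use sums_single[of 0 "\<lambda>_. 1::real"] in \<open>simp add: sums_iff\<close>)
  ultimately have "summable (\<lambda>k. norm (c k))" by simp
  from Cauchy_product_sums[OF this this]
  have "(\<lambda>k. \<Sum>i\<le>k. c i * c (k - i)) sums ((1 - (\<Sum>k. w k * z ^ k)) ^ 2)"
    using c_sums by (simp add: sums_iff power2_eq_square)
  moreover have "(\<Sum>i\<le>k. c i * c (k - i)) = (if k = 0 then 1 else if k = 1 then - (2 / m) * z else 0)" for k
  proof -
    have "(\<Sum>i\<le>k. c i * c (k - i)) = fps_nth ((1 - Abs_fps w) ^ 2) k * z ^ k"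
      unfolding power2_eq_square fps_mult_nth sum_distrib_right atLeast0AtMost
      by (intro sum.cong refl) (simp add: c_def power_add[symmetric] ac_simps)
    then show ?thesis unfolding one_minus_weights_squared by simp
  qed
  moreover have "(\<lambda>k. if k = 0 then 1 else if k = 1 then - (2 / m) * z else 0) sums
      (\<Sum>k\<in>{0, 1::nat}. if k = 0 then 1 else if k = 1 then - (2 / m) * z else 0)"
    by (intro sums_finite) auto
  ultimately show ?thesis by (auto dest: sums_unique2)
qed

lemma m_eq_2: "m = 2"
  using generating_function_squared[of 1] weights_sum m_pos by (simp add: sums_iff field_simps)

lemma generating_function:
  assumes z: "0 \<le> z" "z \<le> 1"
  shows "(\<lambda>k. w k * z ^ k) sums (1 - sqrt (1 - z))"
proof -
  have "(\<Sum>k. w k * z ^ k) \<le> (\<Sum>k. w k)"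
    using z weight_nonneg
    by (intro suminf_le weights_power_summable sums_summable[OF weights_sum]) (simp_all add: mult_left_le power_le_one)
  then have "(\<Sum>k. w k * z ^ k) \<le> 1" using weights_sum by (simp add: sums_iff)
  then have "1 - (\<Sum>k. w k * z ^ k) = sqrt (1 - z)"
    using generating_function_squared[OF z] by (intro real_sqrt_unique[symmetric]) (auto simp: m_eq_2)
  then have "(\<Sum>k. w k * z ^ k) = 1 - sqrt (1 - z)" by simp
  then show ?thesis using weights_power_summable[OF z] by (simp add: sums_iff)
qed

text \<open>
  A visit to \<open>k\<close> can consist of \<open>k\<close> unit steps, and \<open>w 1 = 1 / 2\<close>.
\<close>
lemma weight_pos: "0 < w (Suc k)"
proof -
  have power_nonneg: "0 \<le> fps_nth (Abs_fps w ^ n) d" for n d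
    by (induction n arbitrary: d) (auto simp: fps_mult_nth weight_nonneg intro!: sum_nonneg mult_nonneg_nonneg)
  have "w 1 = 1 / 2" using renewal[of 0] m_eq_2 by simp
  then have "0 < fps_nth (Abs_fps w ^ k) k"
    using weight_0 by (subst startsby_zero_power_nth_same) auto
  also have "\<dots> \<le> (\<Sum>n\<le>k. fps_nth (Abs_fps w ^ n) k)"
    by (rule member_le_sum) (auto simp: power_nonneg)
  also have "\<dots> = m * (real (Suc k) * w (Suc k))" by (simp only: renewal)
  finally show ?thesis using m_pos by (simp add: zero_less_mult_iff)
qed
end

section \<open>The first step of the growth process\<close>

abbreviation step_space :: "step measure" where
  "step_space \<equiv> borel \<Otimes>\<^sub>M (count_space UNIV \<Otimes>\<^sub>M borel)"

abbreviation path_space :: "(nat \<Rightarrow> step) measure" where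
  "path_space \<equiv> \<Pi>\<^sub>M n\<in>UNIV. step_space"

lemma sets_step_law [measurable_cong]: "sets (step_law W) = sets step_space"
  unfolding step_law_def by (intro sets_pair_measure_cong) (auto simp: sets_measure_pmf_count_space)

lemma sets_growth_law [measurable_cong]: "sets (growth_law W) = sets path_space"
  unfolding growth_law_def by (intro sets_PiM_cong refl sets_step_law)

lemma space_growth_law [simp]: "space (growth_law W) = UNIV"
  using sets_eq_imp_space_eq[OF sets_growth_law] by (simp add: space_PiM space_pair_measure)

lemma prob_space_step_law: "prob_space (step_law W)"
proof -
  interpret E: prob_space "density lborel (exponential_density 1)"
    by (rule prob_space_exponential_density) simp
  interpret U: prob_space "uniform_measure lborel {0..<1::real}"
    by (rule prob_space_uniform_measure) auto
  interpret P: pair_prob_space "measure_pmf W" "uniform_measure lborel {0..<1::real}" ..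
  interpret Q: pair_prob_space "density lborel (exponential_density 1)"
    "measure_pmf W \<Otimes>\<^sub>M uniform_measure lborel {0..<1::real}" ..
  show ?thesis unfolding step_law_def by (rule Q.prob_space_axioms)
qed

lemma sequence_space_step_law: "sequence_space (step_law W)"
proof -
  interpret prob_space "step_law W" by (rule prob_space_step_law)
  show ?thesis ..
qed

lemma prob_space_growth_law: "prob_space (growth_law W)"
  unfolding growth_law_def by (intro prob_space_PiM prob_space_step_law)

definition mass :: "step \<Rightarrow> nat" where
  "mass s = num_vertices (fst (snd s))"

text \<open>
  Paths are read from an arbitrary initial size \<open>a\<close>, since after its first step the process goes on
  from a larger cluster with the shifted sequence of steps.
\<close>
definition tail :: "(nat \<Rightarrow> step) \<Rightarrow> nat \<Rightarrow> step" where
  "tail \<omega> n = \<omega> (Suc n)"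

definition size_from :: "nat \<Rightarrow> (nat \<Rightarrow> step) \<Rightarrow> nat \<Rightarrow> nat" where
  "size_from a \<omega> n = a + (\<Sum>i<n. mass (\<omega> i))"

text \<open>
  The conversion to \<open>ennreal\<close> takes place in each summand, so that jump times never decrease, even
  on the null set of paths with negative holding times.
\<close>
definition time_from :: "nat \<Rightarrow> (nat \<Rightarrow> step) \<Rightarrow> nat \<Rightarrow> ennreal" where
  "time_from a \<omega> n = (\<Sum>i<n. ennreal (fst (\<omega> i) / real (size_from a \<omega> i)))"

definition explosion_from :: "nat \<Rightarrow> (nat \<Rightarrow> step) \<Rightarrow> ennreal" where
  "explosion_from a \<omega> = (SUP n. time_from a \<omega> n)"

lemma measurable_num_vertices [measurable]: "num_vertices \<in> measurable (count_space UNIV) (count_space UNIV)"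
  by simp

lemma measurable_mass [measurable]: "mass \<in> measurable step_space (count_space UNIV)"
  unfolding mass_def by measurable

lemma measurable_tail [measurable]: "tail \<in> measurable path_space path_space"
  unfolding tail_def by (rule measurable_PiM_single') (auto simp: space_PiM space_pair_measure)

lemma measurable_size_from [measurable (raw)]:
  assumes [measurable]: "f \<in> measurable M (count_space UNIV)" "g \<in> measurable M path_space"
  shows "(\<lambda>x. size_from (f x) (g x) n) \<in> measurable M (count_space UNIV)"
  unfolding size_from_def by measurable

lemma measurable_time_from [measurable (raw)]:
  assumes [measurable]: "f \<in> measurable M (count_space UNIV)" "g \<in> measurable M path_space"
  shows "(\<lambda>x. time_from (f x) (g x) n) \<in> borel_measurable M"
  unfolding time_from_def by measurable

lemma measurable_explosion_from [measurable (raw)]: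
  assumes [measurable]: "f \<in> measurable M (count_space UNIV)" "g \<in> measurable M path_space"
  shows "(\<lambda>x. explosion_from (f x) (g x)) \<in> borel_measurable M"
  unfolding explosion_from_def by measurable

lemma tail_case_nat: "tail (case_nat s \<omega>) = \<omega>"
  by (simp add: tail_def fun_eq_iff)

lemma size_from_0 [simp]: "size_from a \<omega> 0 = a"
  by (simp add: size_from_def)

lemma size_from_Suc: "size_from a \<omega> (Suc n) = size_from (a + mass (\<omega> 0)) (tail \<omega>) n"
  by (simp add: size_from_def tail_def sum.lessThan_Suc_shift del: sum.lessThan_Suc)

lemma time_from_0 [simp]: "time_from a \<omega> 0 = 0"
  by (simp add: time_from_def)

lemma time_from_Suc:
  "time_from a \<omega> (Suc n) = ennreal (fst (\<omega> 0) / real a) + time_from (a + mass (\<omega> 0)) (tail \<omega>) n"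
  unfolding time_from_def by (subst sum.lessThan_Suc_shift) (simp add: size_from_Suc tail_def)

lemma incseq_time_from: "incseq (time_from a \<omega>)"
  by (intro incseq_SucI) (simp add: time_from_def)

lemma explosion_from_step:
  "explosion_from a \<omega> = ennreal (fst (\<omega> 0) / real a) + explosion_from (a + mass (\<omega> 0)) (tail \<omega>)"
proof -
  have "explosion_from a \<omega> = (SUP n. time_from a \<omega> (Suc n))"
    unfolding explosion_from_def
    using LIMSEQ_SUP[OF incseq_time_from, of a \<omega>] incseq_time_from[of a \<omega>]
    by (intro antisym SUP_mono) (auto intro!: incseq_SucD bexI[of _ "Suc _"])
  then show ?thesis
    by (simp add: time_from_Suc explosion_from_def ennreal_SUP_add_right)
qed

text \<open>
  Dividing a standard exponential variable by \<open>a\<close> gives one of rate \<open>a\<close>; the attachment point is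
  integrated out.
\<close>
lemma nn_integral_holding_step:
  assumes f [measurable]: "(\<lambda>(r, j). f r j) \<in> borel_measurable (borel \<Otimes>\<^sub>M count_space UNIV)"
    and a: "0 < a"
  shows "(\<integral>\<^sup>+ s. f (fst s / real a) (mass s) \<partial>step_law W) =
    (\<integral>\<^sup>+ r. ennreal (exponential_density (real a) r) *
       (\<integral>\<^sup>+ j. f r j \<partial>map_pmf num_vertices W) \<partial>lborel)"
proof -
  interpret U: prob_space "uniform_measure lborel {0..<1::real}"
    by (rule prob_space_uniform_measure) auto
  interpret P: pair_prob_space "measure_pmf W" "uniform_measure lborel {0..<1::real}" ..
  have [measurable (raw)]: "(\<lambda>x. f (g x) (h x)) \<in> borel_measurable M"
    if [measurable]: "g \<in> borel_measurable M" "h \<in> measurable M (count_space UNIV)"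
    for g h and M :: "'c measure"
  proof -
    have "(\<lambda>x. (\<lambda>(r, j). f r j) (g x, h x)) \<in> borel_measurable M" by measurable
    then show ?thesis by simp
  qed
  have "(\<integral>\<^sup>+ s. f (fst s / real a) (mass s) \<partial>step_law W) =
    (\<integral>\<^sup>+ e. \<integral>\<^sup>+ y. f (e / real a) (num_vertices (fst y)) \<partial>(measure_pmf W \<Otimes>\<^sub>M uniform_measure lborel {0..<1::real})
       \<partial>density lborel (exponential_density 1))"
    unfolding step_law_def mass_def by (subst P.nn_integral_fst[symmetric]) simp_all
  also have "\<dots> = (\<integral>\<^sup>+ e. \<integral>\<^sup>+ H. f (e / real a) (num_vertices H) \<partial>measure_pmf W
       \<partial>density lborel (exponential_density 1))"
    by (subst U.nn_integral_fst[symmetric]) (simp_all add: U.emeasure_space_1[simplified])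
  also have "\<dots> = (\<integral>\<^sup>+ e. ennreal (exponential_density 1 e) *
      (\<integral>\<^sup>+ j. f (e / real a) j \<partial>map_pmf num_vertices W) \<partial>lborel)"
    by (simp add: nn_integral_density)
  also have "\<dots> = ennreal \<bar>real a\<bar> * (\<integral>\<^sup>+ r. ennreal (exponential_density 1 (0 + real a * r)) *
      (\<integral>\<^sup>+ j. f ((0 + real a * r) / real a) j \<partial>map_pmf num_vertices W) \<partial>lborel)"
    using a by (intro nn_integral_real_affine) simp_all
  also have "\<dots> = (\<integral>\<^sup>+ r. ennreal (exponential_density (real a) r) *
       (\<integral>\<^sup>+ j. f r j \<partial>map_pmf num_vertices W) \<partial>lborel)"
  proof -
    have "ennreal (real a) * ennreal (exponential_density 1 (real a * r)) = ennreal (exponential_density (real a) r)" for r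
      using a by (simp add: exponential_density_def ennreal_mult[symmetric] mult_less_0_iff mult.commute)
    then show ?thesis using a
      by (subst nn_integral_cmult[symmetric]) (simp_all add: mult.assoc[symmetric])
  qed
  finally show ?thesis .
qed

text \<open>
  The Markov property at the first jump: holding time, increment and future are independent.
\<close>
lemma nn_integral_first_step:
  assumes f [measurable]: "(\<lambda>(r, j, \<omega>). f r j \<omega>) \<in> borel_measurable (borel \<Otimes>\<^sub>M (count_space UNIV \<Otimes>\<^sub>M path_space))"
    and a: "0 < a"
  shows "(\<integral>\<^sup>+ \<omega>. f (fst (\<omega> 0) / real a) (mass (\<omega> 0)) (tail \<omega>) \<partial>growth_law W) =
    (\<integral>\<^sup>+ r. ennreal (exponential_density (real a) r) *
       (\<integral>\<^sup>+ j. \<integral>\<^sup>+ \<omega>. f r j \<omega> \<partial>growth_law W \<partial>map_pmf num_vertices W) \<partial>lborel)"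
proof -
  interpret sequence_space "step_law W" by (rule sequence_space_step_law)
  interpret G: prob_space "growth_law W" by (rule prob_space_growth_law)
  have S: "S = growth_law W" by (simp add: growth_law_def)
  have [measurable (raw)]: "(\<lambda>x. f (g x) (h x) (k x)) \<in> borel_measurable M"
    if [measurable]: "g \<in> borel_measurable M" "h \<in> measurable M (count_space UNIV)"
      "k \<in> measurable M path_space" for g h k and M :: "'c measure"
  proof -
    have "(\<lambda>x. (\<lambda>(r, j, \<omega>). f r j \<omega>) (g x, h x, k x)) \<in> borel_measurable M" by measurable
    then show ?thesis by simp
  qed
  have "(\<integral>\<^sup>+ \<omega>. f (fst (\<omega> 0) / real a) (mass (\<omega> 0)) (tail \<omega>) \<partial>growth_law W) =
    (\<integral>\<^sup>+ \<omega>. f (fst (\<omega> 0) / real a) (mass (\<omega> 0)) (tail \<omega>) \<partial>distr (step_law W \<Otimes>\<^sub>M growth_law W) S (\<lambda>(s, \<omega>). case_nat s \<omega>))"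
    using PiM_iter by (simp add: S)
  also have "\<dots> = (\<integral>\<^sup>+ y. f (fst (fst y) / real a) (mass (fst y)) (snd y) \<partial>(step_law W \<Otimes>\<^sub>M growth_law W))"
    by (subst nn_integral_distr) (simp_all add: S split_beta' tail_case_nat)
  also have "\<dots> = (\<integral>\<^sup>+ s. \<integral>\<^sup>+ \<omega>. f (fst s / real a) (mass s) \<omega> \<partial>growth_law W \<partial>step_law W)"
    by (subst G.nn_integral_fst[symmetric]) simp_all
  also have "\<dots> = (\<integral>\<^sup>+ r. ennreal (exponential_density (real a) r) *
       (\<integral>\<^sup>+ j. \<integral>\<^sup>+ \<omega>. f r j \<omega> \<partial>growth_law W \<partial>map_pmf num_vertices W) \<partial>lborel)"
    by (intro nn_integral_holding_step a) measurable
  finally show ?thesis .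
qed

section \<open>Expected occupation of a given size\<close>

lemma nn_integral_exponential_tail:
  assumes l: "0 < l" and x: "0 \<le> x"
  shows "(\<integral>\<^sup>+ r. ennreal (exponential_density l r) * indicator {x..} r \<partial>lborel) = ennreal (exp (- l * x))"
proof -
  have "((\<lambda>r. - exp (- l * r)) \<longlongrightarrow> 0) at_top"
    using l by real_asymp
  moreover have "((\<lambda>r. - exp (- l * r)) has_real_derivative l * exp (- l * r)) (at r)" for r
    by (auto intro!: derivative_eq_intros)
  ultimately have "(\<integral>\<^sup>+ r. ennreal (l * exp (- l * r)) * indicator {x..} r \<partial>lborel) = ennreal (0 - - exp (- l * x))"
    using l by (intro nn_integral_FTC_atLeast) auto
  moreover have "(\<integral>\<^sup>+ r. ennreal (exponential_density l r) * indicator {x..} r \<partial>lborel)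
      = (\<integral>\<^sup>+ r. ennreal (l * exp (- l * r)) * indicator {x..} r \<partial>lborel)"
    using x by (intro nn_integral_cong) (auto simp: exponential_density_def mult.commute split: split_indicator)
  ultimately show ?thesis by simp
qed

lemma nn_integral_pmf_eq_suminf: "(\<integral>\<^sup>+ j. f j \<partial>measure_pmf p) = (\<Sum>j. ennreal (pmf p j) * f j)"
  for p :: "nat pmf"
  by (simp add: nn_integral_measure_pmf nn_integral_count_space_nat)

text \<open>
  The probability that the cluster started at size \<open>a\<close> has size \<open>k\<close> after \<open>n\<close> steps, as a coefficient
  of the \<open>n\<close>-th power of the generating function of the sizes.
\<close>
definition hit_prob :: "rgraph pmf \<Rightarrow> nat \<Rightarrow> nat \<Rightarrow> nat \<Rightarrow> real" where
  "hit_prob W n a k = (if a \<le> k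
     then fps_nth (Abs_fps (pmf (map_pmf num_vertices W)) ^ n) (k - a) else 0)"

lemma hit_prob_nonneg: "0 \<le> hit_prob W n a k"
proof -
  have "0 \<le> fps_nth (Abs_fps (pmf p) ^ n) d" for n d and p :: "nat pmf"
    by (induction n arbitrary: d) (auto simp: fps_mult_nth intro!: sum_nonneg mult_nonneg_nonneg)
  then show ?thesis by (simp add: hit_prob_def)
qed

lemma hit_prob_Suc:
  "(\<integral>\<^sup>+ j. ennreal (hit_prob W n (a + j) k) \<partial>map_pmf num_vertices W) = ennreal (hit_prob W (Suc n) a k)"
proof -
  let ?p = "map_pmf num_vertices W"
  have "(\<integral>\<^sup>+ j. ennreal (hit_prob W n (a + j) k) \<partial>?p) = (\<Sum>j. ennreal (pmf ?p j * hit_prob W n (a + j) k))"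
    unfolding nn_integral_pmf_eq_suminf by (simp add: ennreal_mult hit_prob_nonneg)
  also have "\<dots> = (\<Sum>j\<in>{j. a + j \<le> k}. ennreal (pmf ?p j * hit_prob W n (a + j) k))"
    by (intro suminf_finite) (auto simp: hit_prob_def intro: finite_subset[of _ "{..k}"])
  also have "\<dots> = ennreal (\<Sum>j\<in>{j. a + j \<le> k}. pmf ?p j * hit_prob W n (a + j) k)"
    by (intro sum_ennreal mult_nonneg_nonneg hit_prob_nonneg) simp
  also have "(\<Sum>j\<in>{j. a + j \<le> k}. pmf ?p j * hit_prob W n (a + j) k) = hit_prob W (Suc n) a k"
  proof (cases "a \<le> k")
    case True
    then have "{j. a + j \<le> k} = {0..k - a}" by auto
    then show ?thesis using True by (auto simp: hit_prob_def fps_mult_nth intro!: sum.cong)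
  next
    case False
    then have "{j. a + j \<le> k} = {}" by auto
    with False show ?thesis by (simp add: hit_prob_def)
  qed
  finally show ?thesis .
qed

text \<open>
  The contribution of the \<open>n\<close>-th holding interval to the integral of \<open>h\<close>(time left until the explosion)
  over the times at which the size is \<open>k\<close>. The variable \<open>r\<close> is the time left until the next jump.
\<close>
definition occupation :: "(ennreal \<Rightarrow> ennreal) \<Rightarrow> nat \<Rightarrow> nat \<Rightarrow> nat \<Rightarrow> (nat \<Rightarrow> step) \<Rightarrow> ennreal" where
  "occupation h k n a \<omega> = (if size_from a \<omega> n = k
     then \<integral>\<^sup>+ r. indicator {0<..fst (\<omega> n) / real k} r *
            h (ennreal r + explosion_from (size_from a \<omega> (Suc n)) ((tail ^^ Suc n) \<omega>)) \<partial>lborel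
     else 0)"

lemma measurable_tail_power [measurable]: "tail ^^ n \<in> measurable path_space path_space"
  by (rule measurable_compose_n) measurable

lemma measurable_occupation [measurable (raw)]:
  assumes [measurable]: "h \<in> borel_measurable borel"
    "f \<in> measurable M (count_space UNIV)" "g \<in> measurable M path_space"
  shows "(\<lambda>x. occupation h k n (f x) (g x)) \<in> borel_measurable M"
  unfolding occupation_def greaterThanAtMost_iff indicator_def by measurable

lemma occupation_Suc: "occupation h k (Suc n) a \<omega> = occupation h k n (a + mass (\<omega> 0)) (tail \<omega>)"
  by (simp add: occupation_def size_from_Suc tail_def funpow_Suc_right del: funpow.simps)

text \<open>
  If \<open>e\<close> is exponential of rate \<open>k\<close> and independent of \<open>R\<close>, the mean of the integral of \<open>h(r + R)\<close>
  over \<open>0 < r \<le> e\<close> is the integral of \<open>exp (- k r)\<close> times the mean of \<open>h(r + R)\<close>, that is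
  \<open>1 / k\<close> times the mean of \<open>h(e + R)\<close>; and \<open>e + R\<close> is the explosion time from size \<open>k\<close>. This settles
  \<open>n = 0\<close>; a first step reduces \<open>n + 1\<close> to \<open>n\<close>.
\<close>
lemma expected_occupation:
  assumes h [measurable]: "h \<in> borel_measurable borel" and k: "0 < k" and a: "0 < a"
  shows "(\<integral>\<^sup>+ \<omega>. occupation h k n a \<omega> \<partial>growth_law W) =
    ennreal (hit_prob W n a k / real k) * (\<integral>\<^sup>+ \<omega>. h (explosion_from k \<omega>) \<partial>growth_law W)"
  using a
proof (induction n arbitrary: a)
  case 0
  interpret G: prob_space "growth_law W" by (rule prob_space_growth_law)
  define \<psi> where "\<psi> r = (\<integral>\<^sup>+ j. \<integral>\<^sup>+ \<omega>. h (ennreal r + explosion_from (k + j) \<omega>) \<partial>growth_law W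
      \<partial>map_pmf num_vertices W)" for r
  have [measurable]: "\<psi> \<in> borel_measurable borel" unfolding \<psi>_def by measurable
  show ?case
  proof (cases "a = k")
    case True
    have "(\<integral>\<^sup>+ \<omega>. occupation h k 0 a \<omega> \<partial>growth_law W) =
        (\<integral>\<^sup>+ \<omega>. \<integral>\<^sup>+ r. indicator {0<..fst (\<omega> 0) / real k} r *
            h (ennreal r + explosion_from (k + mass (\<omega> 0)) (tail \<omega>)) \<partial>lborel \<partial>growth_law W)"
      using True by (simp add: occupation_def size_from_Suc)
    also have "\<dots> = (\<integral>\<^sup>+ s. ennreal (exponential_density (real k) s) *
       (\<integral>\<^sup>+ j. \<integral>\<^sup>+ \<omega>. \<integral>\<^sup>+ r. indicator {0<..s} r * h (ennreal r + explosion_from (k + j) \<omega>) \<partial>lborel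
          \<partial>growth_law W \<partial>map_pmf num_vertices W) \<partial>lborel)"
      unfolding greaterThanAtMost_iff indicator_def by (intro nn_integral_first_step k) measurable
    also have "\<dots> = (\<integral>\<^sup>+ s. ennreal (exponential_density (real k) s) *
       (\<integral>\<^sup>+ r. indicator {0<..s} r * \<psi> r \<partial>lborel) \<partial>lborel)"
    proof -
      have "(\<integral>\<^sup>+ j. \<integral>\<^sup>+ \<omega>. \<integral>\<^sup>+ r. indicator {0<..s} r * h (ennreal r + explosion_from (k + j) \<omega>) \<partial>lborel
          \<partial>growth_law W \<partial>map_pmf num_vertices W) = (\<integral>\<^sup>+ r. indicator {0<..s} r * \<psi> r \<partial>lborel)" for s
      proof -
        interpret LG: pair_sigma_finite lborel "growth_law W" ..
        interpret LP: pair_sigma_finite lborel "map_pmf num_vertices W" ..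
        have "(\<integral>\<^sup>+ \<omega>. \<integral>\<^sup>+ r. indicator {0<..s} r * h (ennreal r + explosion_from (k + j) \<omega>) \<partial>lborel \<partial>growth_law W)
          = (\<integral>\<^sup>+ r. \<integral>\<^sup>+ \<omega>. indicator {0<..s} r * h (ennreal r + explosion_from (k + j) \<omega>) \<partial>growth_law W \<partial>lborel)" for j
          by (intro LG.Fubini') measurable
        moreover have "(\<integral>\<^sup>+ j. \<integral>\<^sup>+ r. \<integral>\<^sup>+ \<omega>. indicator {0<..s} r * h (ennreal r + explosion_from (k + j) \<omega>) \<partial>growth_law W \<partial>lborel \<partial>map_pmf num_vertices W)
          = (\<integral>\<^sup>+ r. \<integral>\<^sup>+ j. \<integral>\<^sup>+ \<omega>. indicator {0<..s} r * h (ennreal r + explosion_from (k + j) \<omega>) \<partial>growth_law W \<partial>map_pmf num_vertices W \<partial>lborel)"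
          by (intro LP.Fubini') measurable
        ultimately show ?thesis unfolding \<psi>_def by (simp add: nn_integral_cmult del: nn_integral_map_pmf)
      qed
      then show ?thesis by simp
    qed
    also have "\<dots> = (\<integral>\<^sup>+ s. \<integral>\<^sup>+ r. ennreal (exponential_density (real k) s) * (indicator {0<..s} r * \<psi> r) \<partial>lborel \<partial>lborel)"
      by (simp add: nn_integral_cmult)
    also have "\<dots> = (\<integral>\<^sup>+ r. \<integral>\<^sup>+ s. ennreal (exponential_density (real k) s) * (indicator {0<..s} r * \<psi> r) \<partial>lborel \<partial>lborel)"
      unfolding greaterThanAtMost_iff indicator_def by (intro lborel_pair.Fubini') measurable
    also have "\<dots> = (\<integral>\<^sup>+ r. indicator {0<..} r * \<psi> r *
        (\<integral>\<^sup>+ s. ennreal (exponential_density (real k) s) * indicator {r..} s \<partial>lborel) \<partial>lborel)"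
      by (subst nn_integral_cmult[symmetric])
         (auto intro!: nn_integral_cong split: split_indicator simp: ac_simps)
    also have "\<dots> = (\<integral>\<^sup>+ r. indicator {0<..} r * \<psi> r * ennreal (exp (- real k * r)) \<partial>lborel)"
      using k by (intro nn_integral_cong) (auto simp: nn_integral_exponential_tail split: split_indicator)
    also have "\<dots> = (\<integral>\<^sup>+ r. ennreal (1 / real k) * (ennreal (exponential_density (real k) r) * \<psi> r) \<partial>lborel)"
    proof (rule nn_integral_cong_AE)
      have "AE r in lborel. r \<noteq> (0::real)" by (rule AE_lborel_singleton)
      then show "AE r in lborel. indicator {0<..} r * \<psi> r * ennreal (exp (- real k * r)) =
          ennreal (1 / real k) * (ennreal (exponential_density (real k) r) * \<psi> r)"
      proof eventually_elim
        case (elim r)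
        have "ennreal (1 / real k) * ennreal (exponential_density (real k) r) = indicator {0<..} r * ennreal (exp (- real k * r))"
          using k elim by (auto simp: exponential_density_def ennreal_mult[symmetric] mult.commute split: split_indicator)
        then show ?case by (metis mult.assoc mult.commute)
      qed
    qed
    also have "\<dots> = ennreal (1 / real k) * (\<integral>\<^sup>+ r. ennreal (exponential_density (real k) r) * \<psi> r \<partial>lborel)"
      by (simp add: nn_integral_cmult)
    also have "(\<integral>\<^sup>+ r. ennreal (exponential_density (real k) r) * \<psi> r \<partial>lborel) =
        (\<integral>\<^sup>+ \<omega>. h (ennreal (fst (\<omega> 0) / real k) + explosion_from (k + mass (\<omega> 0)) (tail \<omega>)) \<partial>growth_law W)"
      unfolding \<psi>_def by (intro nn_integral_first_step[symmetric] k) measurable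
    finally show ?thesis
      using True by (simp add: hit_prob_def explosion_from_step[of k])
  next
    case False
    then show ?thesis by (simp add: occupation_def hit_prob_def)
  qed
next
  case (Suc n)
  let ?Q = "\<integral>\<^sup>+ \<omega>. h (explosion_from k \<omega>) \<partial>growth_law W"
  have "(\<integral>\<^sup>+ \<omega>. occupation h k (Suc n) a \<omega> \<partial>growth_law W) =
    (\<integral>\<^sup>+ r. ennreal (exponential_density (real a) r) *
      (\<integral>\<^sup>+ j. \<integral>\<^sup>+ \<omega>. occupation h k n (a + j) \<omega> \<partial>growth_law W \<partial>map_pmf num_vertices W) \<partial>lborel)"
    unfolding occupation_Suc using Suc.prems
    by (intro nn_integral_first_step[where f="\<lambda>r j. occupation h k n (a + j)"]) measurable
  also have "(\<integral>\<^sup>+ j. \<integral>\<^sup>+ \<omega>. occupation h k n (a + j) \<omega> \<partial>growth_law W \<partial>map_pmf num_vertices W)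
     = (\<integral>\<^sup>+ j. ennreal (hit_prob W n (a + j) k) * (ennreal (1 / real k) * ?Q) \<partial>map_pmf num_vertices W)"
    using Suc by (intro nn_integral_cong) (simp add: mult.assoc[symmetric] ennreal_mult[symmetric] hit_prob_nonneg)
  also have "\<dots> = ennreal (hit_prob W (Suc n) a k) * (ennreal (1 / real k) * ?Q)"
    by (subst nn_integral_multc) (simp_all add: hit_prob_Suc del: nn_integral_map_pmf)
  also have "\<dots> = ennreal (hit_prob W (Suc n) a k / real k) * ?Q"
    by (simp add: mult.assoc[symmetric] ennreal_mult[symmetric] hit_prob_nonneg)
  also have "(\<integral>\<^sup>+ r. ennreal (exponential_density (real a) r) * (ennreal (hit_prob W (Suc n) a k / real k) * ?Q) \<partial>lborel)
    = ennreal (hit_prob W (Suc n) a k / real k) * ?Q"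
  proof -
    have "(\<integral>\<^sup>+ r. ennreal (exponential_density (real a) r) \<partial>lborel)
       = (\<integral>\<^sup>+ r. ennreal (exponential_density (real a) r) * indicator {0..} r \<partial>lborel)"
      by (intro nn_integral_cong) (auto simp: exponential_density_def split: split_indicator)
    then show ?thesis using Suc.prems by (simp add: nn_integral_multc nn_integral_exponential_tail)
  qed
  finally show ?case .
qed

section \<open>An upper bound for the survival probabilities\<close>

text \<open>
  The powers of \<open>sech\<^sup>2\<close> turn the average over the increment into a value of the generating function.
\<close>
lemma sech_power_mixture:
  assumes gen: "\<And>z. 0 \<le> z \<Longrightarrow> z \<le> 1 \<Longrightarrow>
      (\<integral>\<^sup>+ j. ennreal (z ^ j) \<partial>measure_pmf p) = ennreal (1 - sqrt (1 - z))"
    and y: "0 \<le> y"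
  shows "(\<integral>\<^sup>+ j. ennreal (1 / cosh (y / 2) ^ (2 * (a + j))) \<partial>measure_pmf p) =
    ennreal (1 / cosh (y / 2) ^ (2 * a) * (1 - tanh (y / 2)))"
proof -
  have t: "0 \<le> tanh (y / 2)" "tanh (y / 2) < 1" using y tanh_real_lt_1 by auto
  have z: "0 \<le> 1 / cosh (y / 2) ^ 2" "1 / cosh (y / 2) ^ 2 \<le> 1"
    unfolding inverse_cosh_squared using t by (auto simp: power_le_one)
  have "(\<integral>\<^sup>+ j. ennreal (1 / cosh (y / 2) ^ (2 * (a + j))) \<partial>measure_pmf p) =
      (\<integral>\<^sup>+ j. ennreal (1 / cosh (y / 2) ^ (2 * a)) * ennreal ((1 / cosh (y / 2) ^ 2) ^ j) \<partial>measure_pmf p)"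
    by (intro nn_integral_cong)
      (simp add: ennreal_mult[symmetric] power_add power_mult power_one_over)
  also have "\<dots> = ennreal (1 / cosh (y / 2) ^ (2 * a)) * ennreal (1 - sqrt (1 - 1 / cosh (y / 2) ^ 2))"
    by (simp add: nn_integral_cmult gen[OF z])
  also have "sqrt (1 - 1 / cosh (y / 2) ^ 2) = tanh (y / 2)"
    unfolding inverse_cosh_squared using t by simp
  finally show ?thesis using t by (simp add: ennreal_mult[symmetric])
qed

lemma ennreal_less_add_iff:
  assumes "0 \<le> r" "r \<le> x"
  shows "ennreal x < ennreal r + t \<longleftrightarrow> ennreal (x - r) < t"
proof (cases t)
  case (real t')
  then show ?thesis using assms by (simp add: ennreal_less_iff flip: ennreal_plus) auto
qed simp

text \<open>
  The right-hand side solves the first-step equation, which gives the induction step: either the first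
  jump comes after time \<open>x\<close>, or the bound for one jump less applies to what follows it.
\<close>
lemma time_from_tail_bound:
  assumes gen: "\<And>z. 0 \<le> z \<Longrightarrow> z \<le> 1 \<Longrightarrow>
      (\<integral>\<^sup>+ j. ennreal (z ^ j) \<partial>map_pmf num_vertices W) = ennreal (1 - sqrt (1 - z))"
    and "0 \<le> x" "0 < a"
  shows "(\<integral>\<^sup>+ \<omega>. indicator {ennreal x<..} (time_from a \<omega> n) \<partial>growth_law W) \<le> ennreal (1 / cosh (x / 2) ^ (2 * a))"
  using assms(2,3)
proof (induction n arbitrary: a x)
  case 0
  then show ?case by simp
next
  case (Suc n)
  interpret G: prob_space "growth_law W" by (rule prob_space_growth_law)
  let ?I = "\<lambda>r. \<integral>\<^sup>+ j. \<integral>\<^sup>+ \<omega>. indicator {ennreal x<..} (ennreal r + time_from (a + j) \<omega> n) \<partial>growth_law W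
        \<partial>map_pmf num_vertices W"
  let ?g = "\<lambda>r. real a * exp (- real a * r) * (1 / cosh ((x - r) / 2) ^ (2 * a) * (1 - tanh ((x - r) / 2)))"
  have "(\<integral>\<^sup>+ \<omega>. indicator {ennreal x<..} (time_from a \<omega> (Suc n)) \<partial>growth_law W) =
      (\<integral>\<^sup>+ r. ennreal (exponential_density (real a) r) * ?I r \<partial>lborel)"
    unfolding time_from_Suc using Suc.prems
    by (intro nn_integral_first_step[where f="\<lambda>r j \<omega>. indicator {ennreal x<..} (ennreal r + time_from (a + j) \<omega> n)"])
       measurable
  also have "\<dots> \<le> (\<integral>\<^sup>+ r. ennreal (?g r) * indicator {0..x} r
       + ennreal (exponential_density (real a) r) * indicator {x..} r \<partial>lborel)"
  proof (intro nn_integral_mono)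
    fix r :: real
    consider "r < 0" | "0 \<le> r" "r \<le> x" | "x < r" by linarith
    then show "ennreal (exponential_density (real a) r) * ?I r \<le> ennreal (?g r) * indicator {0..x} r
       + ennreal (exponential_density (real a) r) * indicator {x..} r"
    proof cases
      case 1
      then show ?thesis by (simp add: exponential_density_def)
    next
      case 2
      have "?I r = (\<integral>\<^sup>+ j. \<integral>\<^sup>+ \<omega>. indicator {ennreal (x - r)<..} (time_from (a + j) \<omega> n) \<partial>growth_law W
        \<partial>map_pmf num_vertices W)"
        using 2 by (intro nn_integral_cong) (simp add: indicator_def ennreal_less_add_iff)
      also have "\<dots> \<le> (\<integral>\<^sup>+ j. ennreal (1 / cosh ((x - r) / 2) ^ (2 * (a + j))) \<partial>map_pmf num_vertices W)"
        using 2 Suc.prems by (intro nn_integral_mono Suc.IH) auto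
      also have "\<dots> = ennreal (1 / cosh ((x - r) / 2) ^ (2 * a) * (1 - tanh ((x - r) / 2)))"
        using 2 by (intro sech_power_mixture gen) auto
      finally have "ennreal (exponential_density (real a) r) * ?I r \<le> ennreal (real a * exp (- real a * r)) * \<dots>"
        using 2 by (intro mult_mono) (auto simp: exponential_density_def mult.commute)
      also have "\<dots> = ennreal (?g r)"
        by (subst ennreal_mult[symmetric])
           (auto intro!: mult_nonneg_nonneg divide_nonneg_nonneg less_imp_le[OF tanh_real_lt_1])
      finally show ?thesis using 2 by (simp add: add_increasing2)
    next
      case 3
      have "?I r \<le> (\<integral>\<^sup>+ j. \<integral>\<^sup>+ \<omega>. 1 \<partial>growth_law W \<partial>map_pmf num_vertices W)"
        by (intro nn_integral_mono) (simp add: indicator_def)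
      also have "\<dots> = 1" by (simp add: G.emeasure_space_1[simplified])
      finally show ?thesis
        using 3 mult_left_mono[of "?I r" 1 "ennreal (exponential_density (real a) r)"] by (simp add: indicator_def)
    qed
  qed
  also have "\<dots> = (\<integral>\<^sup>+ r. ennreal (?g r) * indicator {0..x} r \<partial>lborel)
       + (\<integral>\<^sup>+ r. ennreal (exponential_density (real a) r) * indicator {x..} r \<partial>lborel)"
  proof (intro nn_integral_add)
    have [measurable]: "?g \<in> borel_measurable borel"
      by (intro borel_measurable_continuous_onI continuous_intros) auto
    show "(\<lambda>r. ennreal (?g r) * indicator {0..x} r) \<in> borel_measurable lborel" by measurable
  qed measurable
  also have "\<dots> = ennreal (1 / cosh (x / 2) ^ (2 * a) - exp (- real a * x)) + ennreal (exp (- real a * x))"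
    using Suc.prems by (simp only: sech_power_backward_equation nn_integral_exponential_tail of_nat_0_less_iff)
  also have "\<dots> = ennreal (1 / cosh (x / 2) ^ (2 * a))"
  proof (subst ennreal_plus[symmetric])
    have "cosh (x / 2) \<le> exp (x / 2)"
      using Suc.prems by (simp add: cosh_def)
    then have "cosh (x / 2) ^ (2 * a) \<le> exp (x / 2) ^ (2 * a)"
      by (intro power_mono) (auto intro: less_imp_le)
    also have "\<dots> = exp (real a * x)" by (simp add: exp_of_nat_mult[symmetric])
    finally show "0 \<le> 1 / cosh (x / 2) ^ (2 * a) - exp (- real a * x)"
      by (simp add: exp_minus inverse_eq_divide frac_le)
  qed simp_all
  finally show ?case .
qed

text \<open>
  In the limit over the number of jumps the bound holds for the event that the explosion comes strictly
  after \<open>x\<close>; by continuity in \<open>x\<close> it extends to \<open>{ennreal x..}\<close>.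
\<close>
lemma explosion_from_tail_bound:
  assumes gen: "\<And>z. 0 \<le> z \<Longrightarrow> z \<le> 1 \<Longrightarrow>
      (\<integral>\<^sup>+ j. ennreal (z ^ j) \<partial>map_pmf num_vertices W) = ennreal (1 - sqrt (1 - z))"
    and x: "0 \<le> x" and a: "0 < a"
  shows "(\<integral>\<^sup>+ \<omega>. indicator {ennreal x..} (explosion_from a \<omega>) \<partial>growth_law W) \<le> ennreal (1 / cosh (x / 2) ^ (2 * a))"
proof (cases "x = 0")
  case True
  interpret G: prob_space "growth_law W" by (rule prob_space_growth_law)
  show ?thesis using True G.emeasure_space_1 by simp
next
  case False
  interpret G: prob_space "growth_law W" by (rule prob_space_growth_law)
  have strict: "(\<integral>\<^sup>+ \<omega>. indicator {ennreal y<..} (explosion_from a \<omega>) \<partial>growth_law W) \<le> ennreal (1 / cosh (y / 2) ^ (2 * a))"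
    if y: "0 \<le> y" for y
  proof -
    have "(indicator {ennreal y<..} (explosion_from a \<omega>) :: ennreal) = (SUP n. indicator {ennreal y<..} (time_from a \<omega> n))" for \<omega>
      by (intro antisym SUP_least)
        (auto simp: explosion_from_def indicator_def less_SUP_iff intro: SUP_upper2)
    moreover have "incseq (\<lambda>n \<omega>. indicator {ennreal y<..} (time_from a \<omega> n) :: ennreal)"
      using incseq_time_from by (auto simp: incseq_def le_fun_def indicator_def) (meson less_le_trans)
    ultimately have "(\<integral>\<^sup>+ \<omega>. indicator {ennreal y<..} (explosion_from a \<omega>) \<partial>growth_law W) =
        (SUP n. \<integral>\<^sup>+ \<omega>. indicator {ennreal y<..} (time_from a \<omega> n) \<partial>growth_law W)"
      by (simp add: nn_integral_monotone_convergence_SUP del: nn_integral_indicator)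
    also have "\<dots> \<le> ennreal (1 / cosh (y / 2) ^ (2 * a))"
      by (intro SUP_least time_from_tail_bound gen y a)
    finally show ?thesis .
  qed
  have "((\<lambda>y. ennreal (1 / cosh (y / 2) ^ (2 * a))) \<longlongrightarrow> ennreal (1 / cosh (x / 2) ^ (2 * a))) (at_left x)"
    by (intro tendsto_intros) auto
  moreover have "eventually (\<lambda>y. (\<integral>\<^sup>+ \<omega>. indicator {ennreal x..} (explosion_from a \<omega>) \<partial>growth_law W)
      \<le> ennreal (1 / cosh (y / 2) ^ (2 * a))) (at_left x)"
  proof -
    have "eventually (\<lambda>y. y \<in> {0<..<x}) (at_left x)"
      using x False by (intro eventually_at_leftI[of 0]) auto
    then show ?thesis
    proof eventually_elim
      case (elim y)
      then have "(\<integral>\<^sup>+ \<omega>. indicator {ennreal x..} (explosion_from a \<omega>) \<partial>growth_law W) \<le>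
         (\<integral>\<^sup>+ \<omega>. indicator {ennreal y<..} (explosion_from a \<omega>) \<partial>growth_law W)"
        by (intro nn_integral_mono)
          (auto simp: indicator_def intro: less_le_trans[of "ennreal y" "ennreal x"] simp: ennreal_less_iff)
      also have "\<dots> \<le> ennreal (1 / cosh (y / 2) ^ (2 * a))"
        using elim by (intro strict) auto
      finally show ?case .
    qed
  qed
  ultimately show ?thesis by (intro tendsto_lowerbound) auto
qed

text \<open>
  Integrating \<open>h\<close> over the interval up to \<open>X\<close> and then taking the mean is integrating \<open>h\<close> against the
  tail of \<open>X\<close>.
\<close>
lemma nn_integral_layer_cake:
  fixes X :: "'a \<Rightarrow> ennreal"
  assumes "sigma_finite_measure M" and [measurable]: "X \<in> borel_measurable M" "h \<in> borel_measurable borel"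
  shows "(\<integral>\<^sup>+ \<omega>. \<integral>\<^sup>+ y. indicator {0<..} y * h y * indicator {ennreal y..} (X \<omega>) \<partial>lborel \<partial>M) =
    (\<integral>\<^sup>+ y. indicator {0<..} y * h y * (\<integral>\<^sup>+ \<omega>. indicator {ennreal y..} (X \<omega>) \<partial>M) \<partial>lborel)"
proof -
  interpret M: sigma_finite_measure M by fact
  interpret P: pair_sigma_finite lborel M ..
  have "(\<integral>\<^sup>+ \<omega>. \<integral>\<^sup>+ y. indicator {0<..} y * h y * indicator {ennreal y..} (X \<omega>) \<partial>lborel \<partial>M) =
    (\<integral>\<^sup>+ y. \<integral>\<^sup>+ \<omega>. indicator {0<..} y * h y * indicator {ennreal y..} (X \<omega>) \<partial>M \<partial>lborel)"
    unfolding atLeast_iff indicator_def by (intro P.Fubini') measurable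
  also have "\<dots> = (\<integral>\<^sup>+ y. indicator {0<..} y * h y * (\<integral>\<^sup>+ \<omega>. indicator {ennreal y..} (X \<omega>) \<partial>M) \<partial>lborel)"
    by (intro nn_integral_cong nn_integral_cmult) measurable
  finally show ?thesis .
qed

lemma nn_integral_eq_tail_integral:
  fixes X :: "'a \<Rightarrow> ennreal"
  assumes "sigma_finite_measure M" and [measurable]: "X \<in> borel_measurable M"
  shows "(\<integral>\<^sup>+ \<omega>. X \<omega> \<partial>M) = (\<integral>\<^sup>+ y. indicator {0<..} y * (\<integral>\<^sup>+ \<omega>. indicator {ennreal y..} (X \<omega>) \<partial>M) \<partial>lborel)"
proof -
  have "(\<integral>\<^sup>+ y. indicator {0<..} y * indicator {ennreal y..} (t::ennreal) \<partial>lborel) = t" for t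
  proof (cases t)
    case (real t')
    then have "(\<integral>\<^sup>+ y. indicator {0<..} y * indicator {ennreal y..} t \<partial>lborel) = (\<integral>\<^sup>+ y. indicator {0<..t'} y \<partial>lborel)"
      by (intro nn_integral_cong) (auto split: split_indicator)
    also have "\<dots> = t" using real by (simp del: nn_integral_indicator add: nn_integral_indicator[of "{0<..t'}" lborel])
    finally show ?thesis .
  next
    case top
    have "emeasure lborel {0::real<..} = top"
    proof (rule ccontr)
      assume "emeasure lborel {0::real<..} \<noteq> top"
      then obtain n :: nat where n: "emeasure lborel {0::real<..} < of_nat n"
        by (auto simp: less_top dest: ennreal_Ex_less_of_nat)
      have "of_nat n = emeasure lborel {0<..real n}" by (simp add: ennreal_of_nat_eq_real_of_nat)
      also have "\<dots> \<le> emeasure lborel {0::real<..}" by (intro emeasure_mono) auto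
      finally show False using n by simp
    qed
    with top show ?thesis by simp
  qed
  then show ?thesis using nn_integral_layer_cake[OF assms, of "\<lambda>_. 1"] by simp
qed

lemma nn_integral_Ioi_eq_Ici:
  "(\<integral>\<^sup>+ y. indicator {0::real<..} y * f y \<partial>lborel) = (\<integral>\<^sup>+ y. f y * indicator {0..} y \<partial>lborel)"
proof (rule nn_integral_cong_AE)
  have "AE y in lborel. y \<noteq> (0::real)" by (rule AE_lborel_singleton)
  then show "AE y in lborel. indicator {0::real<..} y * f y = f y * indicator {0..} y"
    by eventually_elim (auto simp: indicator_def)
qed

section \<open>Cluster sizes along the growth process\<close>

(* The initial size 1 is an instance of a general size a, so it should not be rewritten to Suc 0. *)
declare One_nat_def [simp del]

lemma is_lgraph_rep: "is_lgraph (rep_rgraph H)"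
  using Quotient_rep_reflp[OF Quotient_rgraph, of H] by (simp add: rooted_iso_def)

lemma fst_rep_rgraph: "fst (rep_rgraph H) = num_vertices H"
  by (simp add: num_vertices.rep_eq)

lemma num_vertices_abs: "is_lgraph G \<Longrightarrow> num_vertices (abs_rgraph G) = fst G"
  by (rule num_vertices.abs_eq) (auto simp: eq_onp_def rooted_iso_refl)

lemma num_vertices_pos: "0 < num_vertices H"
  using is_lgraph_rep[of H] by (simp add: is_lgraph_def fst_rep_rgraph)

lemma is_lgraph_attach:
  assumes G: "is_lgraph G" and H: "is_lgraph H" and v: "v < fst G"
  shows "is_lgraph (attach G v H)"
  unfolding is_lgraph_def
proof (intro conjI ballI)
  show "0 < fst (attach G v H)" using G by (simp add: attach_def is_lgraph_def)
next
  fix e assume "e \<in> snd (attach G v H)"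
  then consider "e \<in> snd G" | e' where "e' \<in> snd H" "e = (+) (fst G) ` e'" | "e = {v, fst G}"
    by (auto simp: attach_def)
  then show "\<exists>a<fst (attach G v H). \<exists>b<fst (attach G v H). a \<noteq> b \<and> e = {a, b}"
  proof cases
    case 1
    then obtain a b where "a < fst G" "b < fst G" "a \<noteq> b" "e = {a, b}"
      using G unfolding is_lgraph_def by blast
    then show ?thesis
      by (intro exI[of _ a] conjI exI[of _ b]) (simp_all add: attach_def)
  next
    case 2
    then obtain a b where "a < fst H" "b < fst H" "a \<noteq> b" "e' = {a, b}"
      using H unfolding is_lgraph_def by blast
    with 2 show ?thesis
      by (intro exI[of _ "fst G + a"] conjI exI[of _ "fst G + b"]) (simp_all add: attach_def)
  next
    case 3
    then show ?thesis using v H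
      by (intro exI[of _ v] conjI exI[of _ "fst G"]) (use v in \<open>simp_all add: attach_def is_lgraph_def\<close>)
  qed
qed

text \<open>
  Almost every path is of this kind. On it the attachment points are vertices of the current graph, so
  that all states are graphs, and the jump times increase strictly.
\<close>
definition regular_path :: "(nat \<Rightarrow> step) \<Rightarrow> bool" where
  "regular_path \<omega> \<longleftrightarrow> (\<forall>n. 0 < fst (\<omega> n) \<and> 0 \<le> snd (snd (\<omega> n)) \<and> snd (snd (\<omega> n)) < 1)"

lemma fst_jump_state: "fst (jump_state \<omega> n) = size_from 1 \<omega> n"
  by (induction n) (auto simp: size_from_def mass_def attach_def fst_rep_rgraph split: prod.split)

lemma size_from_pos: "0 < a \<Longrightarrow> 0 < size_from a \<omega> n"
  by (simp add: size_from_def)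

lemma is_lgraph_jump_state:
  assumes "regular_path \<omega>" shows "is_lgraph (jump_state \<omega> n)"
proof (induction n)
  case 0
  show ?case using is_lgraph_singleton by simp
next
  case (Suc n)
  obtain e H u where \<omega>: "\<omega> n = (e, H, u)" by (cases "\<omega> n") auto
  have u: "0 \<le> u" "u < 1" using assms \<omega> unfolding regular_path_def by (metis snd_conv)+
  have "0 < fst (jump_state \<omega> n)" using Suc by (simp add: is_lgraph_def)
  then have "u * real (fst (jump_state \<omega> n)) < real (fst (jump_state \<omega> n))" using u by simp
  then have "nat \<lfloor>u * real (fst (jump_state \<omega> n))\<rfloor> < fst (jump_state \<omega> n)"
    using u by (simp add: nat_less_iff floor_less_iff)
  then show ?case using Suc by (simp add: \<omega> is_lgraph_attach is_lgraph_rep Let_def)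
qed

lemma jump_time_eq: "jump_time \<omega> n = (\<Sum>i<n. fst (\<omega> i) / real (size_from 1 \<omega> i))"
  by (simp add: jump_time_def fst_jump_state)

lemma measurable_explosion_time [measurable]: "explosion_time \<in> borel_measurable path_space"
  unfolding explosion_time_def jump_time_eq by measurable

lemma time_from_eq_jump_time:
  assumes "regular_path \<omega>" shows "time_from 1 \<omega> n = ennreal (jump_time \<omega> n)"
proof -
  have "0 \<le> fst (\<omega> i)" for i using assms by (simp add: regular_path_def less_imp_le)
  then show ?thesis by (simp add: time_from_def jump_time_eq sum_ennreal)
qed

lemma explosion_time_eq: "regular_path \<omega> \<Longrightarrow> explosion_time \<omega> = explosion_from 1 \<omega>"
  by (simp add: explosion_time_def explosion_from_def time_from_eq_jump_time)

lemma strict_mono_jump_time: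
  assumes "regular_path \<omega>" shows "strict_mono (jump_time \<omega>)"
  using assms size_from_pos[of 1 \<omega>] unfolding strict_mono_Suc_iff
  by (auto simp: jump_time_eq regular_path_def)

lemma jump_time_less_explosion:
  assumes \<omega>: "regular_path \<omega>" and t: "explosion_time \<omega> = ennreal t" "0 \<le> t"
  shows "jump_time \<omega> n < t"
proof -
  have "jump_time \<omega> n < jump_time \<omega> (Suc n)"
    using strict_mono_jump_time[OF \<omega>] by (simp add: strict_mono_Suc_iff)
  also have "ennreal (jump_time \<omega> (Suc n)) \<le> ennreal t"
    unfolding t(1)[symmetric] explosion_time_def by (rule SUP_upper) simp
  then have "jump_time \<omega> (Suc n) \<le> t" using t by simp
  finally show ?thesis .
qed

lemma AE_step_law:
  "AE s in step_law W. 0 < fst s \<and> 0 \<le> snd (snd s) \<and> snd (snd s) < 1"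
proof -
  interpret E: prob_space "density lborel (exponential_density 1)"
    by (rule prob_space_exponential_density) simp
  interpret U: prob_space "uniform_measure lborel {0..<1::real}"
    by (rule prob_space_uniform_measure) auto
  interpret P: pair_prob_space "measure_pmf W" "uniform_measure lborel {0..<1::real}" ..
  interpret Q: pair_prob_space "density lborel (exponential_density 1)"
    "measure_pmf W \<Otimes>\<^sub>M uniform_measure lborel {0..<1::real}" ..
  have "AE r in lborel. r \<noteq> (0::real)" by (rule AE_lborel_singleton)
  then have e: "AE r in density lborel (exponential_density 1). 0 < r"
    by (subst AE_density) (auto simp: exponential_density_def elim!: eventually_mono)
  have u: "AE u in uniform_measure lborel {0..<1::real}. 0 \<le> u \<and> u < 1"
    by (rule AE_uniform_measureI) auto
  have y: "AE y in measure_pmf W \<Otimes>\<^sub>M uniform_measure lborel {0..<1::real}. 0 \<le> snd y \<and> snd y < 1"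
    using u by (intro P.AE_pair_measure) auto
  show ?thesis unfolding step_law_def
  proof (rule Q.AE_pair_measure)
    show "AE r in density lborel (exponential_density 1).
        AE y in measure_pmf W \<Otimes>\<^sub>M uniform_measure lborel {0..<1::real}.
          0 < fst (r, y) \<and> 0 \<le> snd (snd (r, y)) \<and> snd (snd (r, y)) < 1"
      using e
    proof eventually_elim
      case (elim r)
      from y show ?case by eventually_elim (use elim in simp)
    qed
  qed measurable
qed

lemma AE_regular_path: "AE \<omega> in growth_law W. regular_path \<omega>"
proof -
  have "AE \<omega> in growth_law W. 0 < fst (\<omega> n) \<and> 0 \<le> snd (snd (\<omega> n)) \<and> snd (snd (\<omega> n)) < 1" for n
    unfolding growth_law_def
    using AE_PiM_component[of UNIV "\<lambda>_. step_law W" n, OF prob_space_step_law UNIV_I AE_step_law] .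
  then show ?thesis by (simp add: regular_path_def AE_all_countable)
qed

lemma measurable_regular_path [measurable]: "Measurable.pred path_space regular_path"
  unfolding regular_path_def by measurable

lemma explosion_from_tail:
  "explosion_from a \<omega> = time_from a \<omega> n + explosion_from (size_from a \<omega> n) ((tail ^^ n) \<omega>)"
proof (induction n arbitrary: a \<omega>)
  case (Suc n)
  have "explosion_from a \<omega> = ennreal (fst (\<omega> 0) / real a) + explosion_from (a + mass (\<omega> 0)) (tail \<omega>)"
    by (rule explosion_from_step)
  also have "\<dots> = time_from a \<omega> (Suc n) + explosion_from (size_from a \<omega> (Suc n)) ((tail ^^ Suc n) \<omega>)"
    by (subst Suc.IH) (simp add: time_from_Suc size_from_Suc funpow_Suc_right add.assoc del: funpow.simps)
  finally show ?case .
qed simp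

text \<open>
  For the observer at the fraction \<open>u\<close> of the lifetime this is \<open>h\<close>(time left until the explosion) if the
  current size is \<open>k\<close>, and \<open>0\<close> otherwise. The sum over the number \<open>n\<close> of jumps so far, with at
  most one nonzero term, makes it measurable and splits the lifetime into holding intervals.
\<close>
definition observable :: "(ennreal \<Rightarrow> ennreal) \<Rightarrow> nat \<Rightarrow> real \<Rightarrow> (nat \<Rightarrow> step) \<Rightarrow> ennreal" where
  "observable h k u \<omega> = (\<Sum>n. if size_from 1 \<omega> n = k \<and>
       time_from 1 \<omega> n \<le> ennreal u * explosion_from 1 \<omega> \<and> ennreal u * explosion_from 1 \<omega> < time_from 1 \<omega> (Suc n)
     then h (ennreal (1 - u) * explosion_from 1 \<omega>) else 0)"

lemma measurable_observable [measurable (raw)]: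
  assumes [measurable]: "h \<in> borel_measurable borel" "f \<in> borel_measurable M" "g \<in> measurable M path_space"
  shows "(\<lambda>x. observable h k (f x) (g x)) \<in> borel_measurable M"
  unfolding observable_def by measurable

lemma observable_eq:
  assumes \<omega>: "regular_path \<omega>" and t: "explosion_time \<omega> = ennreal t" "0 \<le> t" and u: "0 \<le> u" "u < 1"
  shows "observable h k u \<omega> =
    (if num_vertices (growth_process \<omega> (u * t)) = k then h (ennreal ((1 - u) * t)) else 0)"
proof -
  note sm = strict_mono_jump_time[OF \<omega>]
  have "0 < t" using jump_time_less_explosion[OF \<omega> t, of 0] by (simp add: jump_time_def)
  then have "u * t < t" using u by simp
  then have "ennreal (u * t) < explosion_time \<omega>" using t u by (simp add: ennreal_less_iff)
  then obtain m where m: "ennreal (u * t) < ennreal (jump_time \<omega> m)"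
    unfolding explosion_time_def less_SUP_iff by auto
  have ex: "\<exists>n. u * t < jump_time \<omega> (Suc n)"
  proof (intro exI[of _ m])
    have "u * t < jump_time \<omega> m" using m u t by (simp add: ennreal_less_iff)
    also have "\<dots> < jump_time \<omega> (Suc m)" using sm by (simp add: strict_mono_Suc_iff)
    finally show "u * t < jump_time \<omega> (Suc m)" .
  qed
  define N where "N = (LEAST n. u * t < jump_time \<omega> (Suc n))"
  have N1: "u * t < jump_time \<omega> (Suc N)" unfolding N_def by (rule LeastI_ex[OF ex])
  have N2: "jump_time \<omega> N \<le> u * t"
  proof (cases N)
    case (Suc n)
    then show ?thesis using not_less_Least[of n "\<lambda>n. u * t < jump_time \<omega> (Suc n)"] by (simp add: N_def)
  qed (use u t in \<open>simp add: jump_time_def\<close>)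
  have e: "ennreal u * explosion_from 1 \<omega> = ennreal (u * t)" "ennreal (1 - u) * explosion_from 1 \<omega> = ennreal ((1 - u) * t)"
    using u t by (simp_all add: explosion_time_eq[OF \<omega>] ennreal_mult)
  have pos: "0 \<le> jump_time \<omega> n" for n
    using strict_mono_less_eq[OF sm, of 0 n] by (simp add: jump_time_def)
  have iff: "time_from 1 \<omega> n \<le> ennreal (u * t) \<and> ennreal (u * t) < time_from 1 \<omega> (Suc n) \<longleftrightarrow> n = N" for n
  proof -
    have "time_from 1 \<omega> n \<le> ennreal (u * t) \<and> ennreal (u * t) < time_from 1 \<omega> (Suc n) \<longleftrightarrow>
        jump_time \<omega> n \<le> u * t \<and> u * t < jump_time \<omega> (Suc n)"
      using u t pos by (simp add: time_from_eq_jump_time[OF \<omega>] ennreal_less_iff ennreal_le_iff)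
    also have "\<dots> \<longleftrightarrow> n = N"
    proof
      assume n: "jump_time \<omega> n \<le> u * t \<and> u * t < jump_time \<omega> (Suc n)"
      then have "jump_time \<omega> n < jump_time \<omega> (Suc N)" "jump_time \<omega> N < jump_time \<omega> (Suc n)"
        using N1 N2 by linarith+
      then show "n = N" using strict_mono_less[OF sm] by simp
    qed (use N1 N2 in simp)
    finally show ?thesis .
  qed
  have "observable h k u \<omega> = (\<Sum>n. if n = N then (if size_from 1 \<omega> N = k then h (ennreal ((1 - u) * t)) else 0) else 0)"
    unfolding observable_def e iff by (intro suminf_cong) auto
  also have "\<dots> = (if size_from 1 \<omega> N = k then h (ennreal ((1 - u) * t)) else 0)"
    by (subst suminf_finite[of "{N}"]) auto
  also have "size_from 1 \<omega> N = num_vertices (growth_process \<omega> (u * t))"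
    unfolding growth_process_def
    by (subst num_vertices_abs) (simp_all add: is_lgraph_jump_state[OF \<omega>] fst_jump_state N_def)
  finally show ?thesis .
qed

text \<open>
  On the \<open>n\<close>-th holding interval substitute \<open>r = J - t u\<close>, where \<open>t\<close> is the lifetime and \<open>J\<close> the jump time
  that ends the interval; the Jacobian is the factor \<open>t\<close> of the size bias.
\<close>
lemma observable_integral:
  assumes \<omega>: "regular_path \<omega>" and t: "explosion_time \<omega> = ennreal t" "0 \<le> t"
    and h [measurable]: "h \<in> borel_measurable borel"
  shows "explosion_time \<omega> * (\<integral>\<^sup>+ u. indicator {0..<1} u * observable h k u \<omega> \<partial>lborel) = (\<Sum>n. occupation h k n 1 \<omega>)"
proof -
  note sm = strict_mono_jump_time[OF \<omega>]
  have t0: "0 < t" using jump_time_less_explosion[OF \<omega> t, of 0] by (simp add: jump_time_def)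
  have pos: "0 \<le> jump_time \<omega> n" for n
    using strict_mono_less_eq[OF sm, of 0 n] by (simp add: jump_time_def)
  have [measurable]: "\<omega> \<in> space path_space" by (simp add: space_PiM space_pair_measure)
  have "explosion_time \<omega> * (\<integral>\<^sup>+ u. indicator {0..<1} u * observable h k u \<omega> \<partial>lborel) =
    (\<Sum>n. explosion_time \<omega> * (\<integral>\<^sup>+ u. indicator {0..<1} u * (if size_from 1 \<omega> n = k \<and>
       time_from 1 \<omega> n \<le> ennreal u * explosion_from 1 \<omega> \<and> ennreal u * explosion_from 1 \<omega> < time_from 1 \<omega> (Suc n)
     then h (ennreal (1 - u) * explosion_from 1 \<omega>) else 0) \<partial>lborel))"
    unfolding observable_def ennreal_suminf_cmult[symmetric]
    by (subst nn_integral_suminf) simp_all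
  also have "\<dots> = (\<Sum>n. occupation h k n 1 \<omega>)"
  proof (rule suminf_cong)
    fix n
    define R where "R = explosion_from (size_from 1 \<omega> (Suc n)) ((tail ^^ Suc n) \<omega>)"
    have R: "R = ennreal (t - jump_time \<omega> (Suc n))"
    proof -
      have "ennreal t = ennreal (jump_time \<omega> (Suc n)) + R"
        using explosion_from_tail[of 1 \<omega> "Suc n"] t explosion_time_eq[OF \<omega>] time_from_eq_jump_time[OF \<omega>]
        by (simp add: R_def)
      then have "R = ennreal t - ennreal (jump_time \<omega> (Suc n))" by simp
      then show ?thesis using pos by (simp add: ennreal_minus)
    qed
    have step: "jump_time \<omega> (Suc n) = jump_time \<omega> n + fst (\<omega> n) / real (size_from 1 \<omega> n)"
      by (simp add: jump_time_eq)
    show "explosion_time \<omega> * (\<integral>\<^sup>+ u. indicator {0..<1} u * (if size_from 1 \<omega> n = k \<and>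
       time_from 1 \<omega> n \<le> ennreal u * explosion_from 1 \<omega> \<and> ennreal u * explosion_from 1 \<omega> < time_from 1 \<omega> (Suc n)
     then h (ennreal (1 - u) * explosion_from 1 \<omega>) else 0) \<partial>lborel) = occupation h k n 1 \<omega>"
    proof (cases "size_from 1 \<omega> n = k")
      case True
      have "occupation h k n 1 \<omega> = (\<integral>\<^sup>+ r. indicator {0<..fst (\<omega> n) / real k} r * h (ennreal r + R) \<partial>lborel)"
        using True by (simp add: occupation_def R_def)
      also have "\<dots> = ennreal \<bar>- t\<bar> * (\<integral>\<^sup>+ u. indicator {0<..fst (\<omega> n) / real k} (jump_time \<omega> (Suc n) + (- t) * u)
           * h (ennreal (jump_time \<omega> (Suc n) + (- t) * u) + R) \<partial>lborel)"
        using t0 by (intro nn_integral_real_affine) auto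
      also have "(\<integral>\<^sup>+ u. indicator {0<..fst (\<omega> n) / real k} (jump_time \<omega> (Suc n) + (- t) * u)
           * h (ennreal (jump_time \<omega> (Suc n) + (- t) * u) + R) \<partial>lborel) =
         (\<integral>\<^sup>+ u. indicator {0..<1} u * (if size_from 1 \<omega> n = k \<and>
           time_from 1 \<omega> n \<le> ennreal u * explosion_from 1 \<omega> \<and> ennreal u * explosion_from 1 \<omega> < time_from 1 \<omega> (Suc n)
           then h (ennreal (1 - u) * explosion_from 1 \<omega>) else 0) \<partial>lborel)"
      proof (intro nn_integral_cong)
        fix u :: real
        show "indicator {0<..fst (\<omega> n) / real k} (jump_time \<omega> (Suc n) + (- t) * u)
           * h (ennreal (jump_time \<omega> (Suc n) + (- t) * u) + R) =
          indicator {0..<1} u * (if size_from 1 \<omega> n = k \<and>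
           time_from 1 \<omega> n \<le> ennreal u * explosion_from 1 \<omega> \<and> ennreal u * explosion_from 1 \<omega> < time_from 1 \<omega> (Suc n)
           then h (ennreal (1 - u) * explosion_from 1 \<omega>) else 0)"
        proof (cases "0 \<le> u \<and> u < 1")
          case u: True
          have e: "ennreal u * explosion_from 1 \<omega> = ennreal (u * t)"
            "ennreal (1 - u) * explosion_from 1 \<omega> = ennreal ((1 - u) * t)"
            using u t explosion_time_eq[OF \<omega>] by (simp_all add: ennreal_mult)
          have c: "time_from 1 \<omega> n \<le> ennreal (u * t) \<and> ennreal (u * t) < time_from 1 \<omega> (Suc n) \<longleftrightarrow>
              jump_time \<omega> (Suc n) + (- t) * u \<in> {0<..fst (\<omega> n) / real k}"
            using u t pos step True
            by (auto simp add: time_from_eq_jump_time[OF \<omega>] ennreal_less_iff ennreal_le_iff mult.commute)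
          show ?thesis
          proof (cases "jump_time \<omega> (Suc n) + (- t) * u \<in> {0<..fst (\<omega> n) / real k}")
            case in_interval: True
            then have "ennreal (jump_time \<omega> (Suc n) + (- t) * u) + R = ennreal ((1 - u) * t)"
              unfolding R using jump_time_less_explosion[OF \<omega> t, of "Suc n"]
              by (subst ennreal_plus[symmetric]) (auto simp: algebra_simps)
            then show ?thesis using u in_interval True unfolding e c by simp
          next
            case False
            then show ?thesis unfolding e c
              by (simp only: indicator_simps simp_thms if_False mult_zero_left mult_zero_right)
          qed
        next
          case False
          have "jump_time \<omega> (Suc n) + (- t) * u \<notin> {0<..fst (\<omega> n) / real k}"
          proof
            assume "jump_time \<omega> (Suc n) + (- t) * u \<in> {0<..fst (\<omega> n) / real k}"
            then have "jump_time \<omega> n \<le> t * u" "t * u < jump_time \<omega> (Suc n)" using step True by auto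
            then have "0 \<le> t * u" "t * u < t * 1" using pos[of n] jump_time_less_explosion[OF \<omega> t, of "Suc n"] by linarith+
            then have "0 \<le> u \<and> u < 1" using t0 by (simp add: zero_le_mult_iff)
            with False show False by simp
          qed
          then show ?thesis using False by (auto simp: indicator_def)
        qed
      qed
      finally show ?thesis using t0 t by simp
    qed (simp add: occupation_def)
  qed
  finally show ?thesis .
qed

lemma uniform_position_integral:
  assumes t: "0 < t" and h [measurable]: "h \<in> borel_measurable borel"
  shows "ennreal t * (\<integral>\<^sup>+ u. indicator {0..<1} u * h (ennreal ((1 - u) * t)) \<partial>lborel) =
    (\<integral>\<^sup>+ y. indicator {0<..} y * h (ennreal y) * indicator {ennreal y..} (ennreal t) \<partial>lborel)"
proof -
  have "(\<integral>\<^sup>+ y. indicator {0<..} y * h (ennreal y) * indicator {ennreal y..} (ennreal t) \<partial>lborel) =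
     (\<integral>\<^sup>+ y. indicator {0<..t} y * h (ennreal y) \<partial>lborel)"
    using t by (intro nn_integral_cong) (auto simp: indicator_def)
  also have "\<dots> = ennreal \<bar>- t\<bar> * (\<integral>\<^sup>+ u. indicator {0<..t} (t + (- t) * u) * h (ennreal (t + (- t) * u)) \<partial>lborel)"
    using t by (intro nn_integral_real_affine) auto
  also have "(\<integral>\<^sup>+ u. indicator {0<..t} (t + (- t) * u) * h (ennreal (t + (- t) * u)) \<partial>lborel) =
      (\<integral>\<^sup>+ u. indicator {0..<1} u * h (ennreal ((1 - u) * t)) \<partial>lborel)"
    using t by (intro nn_integral_cong) (auto simp: indicator_def algebra_simps zero_le_mult_iff)
  finally show ?thesis using t by simp
qed

section \<open>The stationary law seen from time zero\<close>

lemma sets_size_biased_law [measurable_cong]: "sets (size_biased_law W) = sets path_space"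
  by (simp add: size_biased_law_def sets_growth_law)

lemma sets_stationary_law [measurable_cong]:
  "sets (stationary_law W) = sets (borel \<Otimes>\<^sub>M (\<Pi>\<^sub>M i\<in>(UNIV::int set). path_space))"
  unfolding stationary_law_def
  by (intro sets_pair_measure_cong sets_PiM_cong) (auto simp: sets_size_biased_law sets_growth_law)

lemma space_stationary_law [simp]: "space (stationary_law W) = UNIV"
  using sets_eq_imp_space_eq[OF sets_stationary_law] by (simp add: space_PiM space_pair_measure)

definition mean_explosion :: "rgraph pmf \<Rightarrow> ennreal" where
  "mean_explosion W = (\<integral>\<^sup>+ \<omega>. explosion_time \<omega> \<partial>growth_law W)"

lemma explosion_time_pos: "regular_path \<omega> \<Longrightarrow> 0 < explosion_time \<omega>"
proof -
  assume \<omega>: "regular_path \<omega>"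
  then have "0 < ennreal (jump_time \<omega> (Suc 0))" by (simp add: jump_time_eq regular_path_def)
  also have "\<dots> \<le> explosion_time \<omega>" unfolding explosion_time_def by (rule SUP_upper) simp
  finally show ?thesis .
qed

lemma mean_explosion_neq_0: "mean_explosion W \<noteq> 0"
proof
  interpret G: prob_space "growth_law W" by (rule prob_space_growth_law)
  assume "mean_explosion W = 0"
  then have "AE \<omega> in growth_law W. explosion_time \<omega> = 0"
    unfolding mean_explosion_def by (subst (asm) nn_integral_0_iff_AE) measurable
  with AE_regular_path[of W] have "AE \<omega> in growth_law W. False"
    by eventually_elim (use explosion_time_pos in force)
  then show False by simp
qed

locale finite_mean_growth =
  fixes W :: "rgraph pmf"
  assumes explodes: "AE \<omega> in growth_law W. explosion_time \<omega> < \<infinity>"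
    and mean_finite: "mean_explosion W < \<infinity>"
begin

lemma prob_space_size_biased_law: "prob_space (size_biased_law W)"
proof
  have "emeasure (size_biased_law W) (space (size_biased_law W)) =
     (\<integral>\<^sup>+ \<omega>. explosion_time \<omega> / mean_explosion W \<partial>growth_law W)"
    unfolding size_biased_law_def mean_explosion_def[symmetric]
    by (subst emeasure_density) (use sets.top[of "growth_law W"] in simp_all)
  also have "\<dots> = mean_explosion W / mean_explosion W"
    by (simp add: nn_integral_divide mean_explosion_def)
  also have "\<dots> = 1" using mean_explosion_neq_0 mean_finite by (simp add: ennreal_divide_self)
  finally show "emeasure (size_biased_law W) (space (size_biased_law W)) = 1" .
qed

lemma prob_space_stationary_law: "prob_space (stationary_law W)"
proof -
  interpret U: prob_space "uniform_measure lborel {0..<1::real}"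
    by (rule prob_space_uniform_measure) auto
  interpret P: prob_space "\<Pi>\<^sub>M i\<in>(UNIV::int set). if i = 0 then size_biased_law W else growth_law W"
    by (intro prob_space_PiM) (simp add: prob_space_size_biased_law prob_space_growth_law)
  interpret Q: pair_prob_space "uniform_measure lborel {0..<1::real}"
     "\<Pi>\<^sub>M i\<in>(UNIV::int set). if i = 0 then size_biased_law W else growth_law W" ..
  show ?thesis unfolding stationary_law_def by (rule Q.prob_space_axioms)
qed

text \<open>
  Only the copy whose interval contains \<open>0\<close> and the position of \<open>0\<close> in it enter, and the density of the
  size-biased law is written out.
\<close>
lemma stationary_integral:
  assumes F: "(\<lambda>(u, \<omega>). F u \<omega>) \<in> borel_measurable (borel \<Otimes>\<^sub>M path_space)"
  shows "(\<integral>\<^sup>+ x. F (fst x) (snd x 0) \<partial>stationary_law W) =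
    (\<integral>\<^sup>+ \<omega>. explosion_time \<omega> * (\<integral>\<^sup>+ u. indicator {0..<1} u * F u \<omega> \<partial>lborel) \<partial>growth_law W) / mean_explosion W"
proof -
  interpret U: prob_space "uniform_measure lborel {0..<1::real}"
    by (rule prob_space_uniform_measure) auto
  let ?L = "\<lambda>i::int. if i = 0 then size_biased_law W else growth_law W"
  let ?P = "\<Pi>\<^sub>M i\<in>UNIV. ?L i"
  have L: "prob_space (?L i)" for i
    by (simp add: prob_space_size_biased_law prob_space_growth_law)
  interpret P: prob_space ?P by (intro prob_space_PiM L)
  interpret G: prob_space "growth_law W" by (rule prob_space_growth_law)
  interpret LG: pair_sigma_finite lborel "growth_law W" ..
  have [measurable]: "(\<lambda>x. F (g x) (k x)) \<in> borel_measurable M"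
    if [measurable]: "g \<in> borel_measurable M" "k \<in> measurable M path_space" for g k and M :: "'c measure"
  proof -
    have "(\<lambda>x. (\<lambda>(u, \<omega>). F u \<omega>) (g x, k x)) \<in> borel_measurable M" using F by measurable
    then show ?thesis by simp
  qed
  have sP [measurable_cong]: "sets ?P = sets (\<Pi>\<^sub>M i\<in>(UNIV::int set). path_space)"
    by (intro sets_PiM_cong) (auto simp: sets_size_biased_law sets_growth_law)
  have sL [measurable_cong]: "sets (?L i) = sets path_space" for i
    by (simp add: sets_size_biased_law sets_growth_law)
  have inner: "(\<integral>\<^sup>+ X. F u (X 0) \<partial>?P) = (\<integral>\<^sup>+ \<omega>. explosion_time \<omega> / mean_explosion W * F u \<omega> \<partial>growth_law W)" for u
  proof -
    have "(\<integral>\<^sup>+ X. F u (X 0) \<partial>?P) = (\<integral>\<^sup>+ \<omega>. F u \<omega> \<partial>distr ?P (?L 0) (\<lambda>X. X 0))"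
      by (subst nn_integral_distr) simp_all
    also have "distr ?P (?L 0) (\<lambda>X. X 0) = ?L 0"
      by (intro distr_PiM_component L) simp
    finally show ?thesis
      by (simp add: size_biased_law_def nn_integral_density mean_explosion_def)
  qed
  have "(\<integral>\<^sup>+ x. F (fst x) (snd x 0) \<partial>stationary_law W) =
    (\<integral>\<^sup>+ u. \<integral>\<^sup>+ X. F u (X 0) \<partial>?P \<partial>uniform_measure lborel {0..<1})"
    unfolding stationary_law_def by (subst P.nn_integral_fst[symmetric]) simp_all
  also have "\<dots> = (\<integral>\<^sup>+ u. indicator {0..<1} u * (\<integral>\<^sup>+ \<omega>. explosion_time \<omega> / mean_explosion W * F u \<omega> \<partial>growth_law W) \<partial>lborel)"
    unfolding inner by (subst nn_integral_uniform_measure) (simp_all add: mult.commute divide_ennreal_def)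
  also have "\<dots> = (\<integral>\<^sup>+ u. \<integral>\<^sup>+ \<omega>. indicator {0..<1} u * (explosion_time \<omega> / mean_explosion W * F u \<omega>) \<partial>growth_law W \<partial>lborel)"
    by (simp add: nn_integral_cmult)
  also have "\<dots> = (\<integral>\<^sup>+ \<omega>. \<integral>\<^sup>+ u. indicator {0..<1} u * (explosion_time \<omega> / mean_explosion W * F u \<omega>) \<partial>lborel \<partial>growth_law W)"
    by (intro LG.Fubini'[symmetric]) measurable
  also have "\<dots> = (\<integral>\<^sup>+ \<omega>. (explosion_time \<omega> * (\<integral>\<^sup>+ u. indicator {0..<1} u * F u \<omega> \<partial>lborel)) / mean_explosion W \<partial>growth_law W)"
  proof (intro nn_integral_cong)
    fix \<omega> :: "nat \<Rightarrow> step"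
    have [measurable]: "\<omega> \<in> space path_space" by (simp add: space_PiM space_pair_measure)
    have "(\<integral>\<^sup>+ u. indicator {0..<1} u * (explosion_time \<omega> / mean_explosion W * F u \<omega>) \<partial>lborel) =
       (\<integral>\<^sup>+ u. (explosion_time \<omega> / mean_explosion W) * (indicator {0..<1} u * F u \<omega>) \<partial>lborel)"
      by (simp add: mult.left_commute)
    also have "\<dots> = (explosion_time \<omega> / mean_explosion W) * (\<integral>\<^sup>+ u. indicator {0..<1} u * F u \<omega> \<partial>lborel)"
      by (intro nn_integral_cmult) measurable
    finally show "(\<integral>\<^sup>+ u. indicator {0..<1} u * (explosion_time \<omega> / mean_explosion W * F u \<omega>) \<partial>lborel) =
       (explosion_time \<omega> * (\<integral>\<^sup>+ u. indicator {0..<1} u * F u \<omega> \<partial>lborel)) / mean_explosion W"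
      by (simp add: divide_ennreal_def mult.assoc mult.left_commute mult.commute)
  qed
  also have "\<dots> = (\<integral>\<^sup>+ \<omega>. explosion_time \<omega> * (\<integral>\<^sup>+ u. indicator {0..<1} u * F u \<omega> \<partial>lborel) \<partial>growth_law W) / mean_explosion W"
    by (intro nn_integral_divide) measurable
  finally show ?thesis .
qed

lemma AE_stationary_law:
  "AE x in stationary_law W. 0 \<le> fst x \<and> fst x < 1 \<and> regular_path (snd x 0) \<and> explosion_time (snd x 0) < \<infinity>"
proof -
  define F :: "real \<Rightarrow> (nat \<Rightarrow> step) \<Rightarrow> ennreal" where
    "F u \<omega> = (if 0 \<le> u \<and> u < 1 \<and> regular_path \<omega> \<and> explosion_time \<omega> < \<infinity> then 0 else 1)" for u \<omega>
  have F [measurable]: "(\<lambda>(u, \<omega>). F u \<omega>) \<in> borel_measurable (borel \<Otimes>\<^sub>M path_space)"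
    unfolding F_def by measurable
  have "AE \<omega> in growth_law W. explosion_time \<omega> * (\<integral>\<^sup>+ u. indicator {0..<1} u * F u \<omega> \<partial>lborel) = 0"
    using explodes AE_regular_path[of W]
  proof eventually_elim
    case (elim \<omega>)
    then have "(\<integral>\<^sup>+ u. indicator {0..<1} u * F u \<omega> \<partial>lborel) = (\<integral>\<^sup>+ u. 0 \<partial>(lborel :: real measure))"
      by (intro nn_integral_cong) (auto simp: F_def indicator_def)
    then show ?case by simp
  qed
  then have "(\<integral>\<^sup>+ \<omega>. explosion_time \<omega> * (\<integral>\<^sup>+ u. indicator {0..<1} u * F u \<omega> \<partial>lborel) \<partial>growth_law W) =
      (\<integral>\<^sup>+ \<omega>. 0 \<partial>growth_law W)"
    by (rule nn_integral_cong_AE)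
  then have "(\<integral>\<^sup>+ x. F (fst x) (snd x 0) \<partial>stationary_law W) = 0"
    unfolding stationary_integral[OF F] by simp
  then have "AE x in stationary_law W. F (fst x) (snd x 0) = 0"
    by (subst (asm) nn_integral_0_iff_AE) (auto simp: F_def)
  then show ?thesis by eventually_elim (auto simp: F_def split: if_splits)
qed

end

lemma lifetime_nonneg: "0 \<le> lifetime x i"
  by (simp add: lifetime_def)

lemma start_time_add_1: "start_time x (i + 1) = start_time x i + lifetime x i"
proof (cases "0 \<le> i")
  case True
  then have "{0..<i + 1} = insert i {0..<i}" by auto
  with True show ?thesis by (simp add: start_time_def)
next
  case False
  show ?thesis
  proof (cases "i = -1")
    case True
    have "{-1..<0::int} = {-1}" by auto
    then show ?thesis using True by (simp add: start_time_def)
  next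
    case False
    with \<open>\<not> 0 \<le> i\<close> have "{i..<0} = insert i {i + 1..<0}" "\<not> 0 \<le> i + 1" by auto
    with \<open>\<not> 0 \<le> i\<close> show ?thesis by (simp add: start_time_def)
  qed
qed

lemma start_time_mono: "i \<le> j \<Longrightarrow> start_time x i \<le> start_time x j"
proof (induction j rule: int_ge_induct)
  case (step j)
  then show ?case using start_time_add_1[of x j] lifetime_nonneg[of x j] by linarith
qed simp

lemma start_time_0: "start_time x 0 = - fst x * lifetime x 0"
  by (simp add: start_time_def)

lemma start_time_1: "start_time x 1 = (1 - fst x) * lifetime x 0"
  using start_time_add_1[of x 0] by (simp add: start_time_0 algebra_simps)

lemma first_explosion_eq:
  assumes "0 \<le> fst x" "fst x < 1" "0 < lifetime x 0"
  shows "first_explosion x = (1 - fst x) * lifetime x 0"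
  unfolding first_explosion_def start_time_1[symmetric]
proof (rule cInf_eq_minimum)
  show "start_time x 1 \<in> {start_time x i |i. 0 < start_time x i}"
    using assms by (auto simp: start_time_1 intro!: exI[of _ 1])
  fix y assume "y \<in> {start_time x i |i. 0 < start_time x i}"
  then obtain i where i: "y = start_time x i" "0 < start_time x i" by auto
  have "start_time x 0 \<le> 0" using assms by (simp add: start_time_0)
  then have "\<not> i \<le> 0" using start_time_mono[of i 0 x] i by linarith
  then show "start_time x 1 \<le> y" using i start_time_mono[of 1 i x] by simp
qed

lemma stationary_process_0:
  assumes "0 \<le> fst x" "fst x < 1" "0 < lifetime x 0"
  shows "stationary_process x 0 = growth_process (snd x 0) (fst x * lifetime x 0)"
proof -
  have "(THE i. start_time x i \<le> 0 \<and> 0 < start_time x (i + 1)) = 0"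
  proof (rule the_equality)
    show "start_time x 0 \<le> 0 \<and> 0 < start_time x (0 + 1)"
      using assms by (simp add: start_time_0 start_time_1)
    then have s: "start_time x 0 \<le> 0" "0 < start_time x 1" by auto
    fix i assume i: "start_time x i \<le> 0 \<and> 0 < start_time x (i + 1)"
    then have "\<not> 1 \<le> i" "\<not> i + 1 \<le> 0"
      using s start_time_mono[of 1 i x] start_time_mono[of "i + 1" 0 x] by linarith+
    then show "i = 0" by simp
  qed
  then show ?thesis by (simp add: stationary_process_def start_time_0)
qed

text \<open>
  The default value \<open>Inf {}\<close> is taken where no interval starts after \<open>0\<close>.
\<close>
lemma measurable_first_explosion [measurable]: "first_explosion \<in> borel_measurable (stationary_law W)"
proof -
  have [measurable]: "(\<lambda>x. lifetime x i) \<in> borel_measurable (stationary_law W)" for i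
    unfolding lifetime_def by measurable
  have [measurable]: "(\<lambda>x. start_time x i) \<in> borel_measurable (stationary_law W)" for i
    unfolding start_time_def by measurable
  have *: "first_explosion x < c \<longleftrightarrow> (if \<exists>i. 0 < start_time x i
      then \<exists>i. 0 < start_time x i \<and> start_time x i < c else Inf {} < c)" for x c
  proof (cases "\<exists>i. 0 < start_time x i")
    case True
    have "bdd_below {start_time x i |i. 0 < start_time x i}" by (auto intro!: bdd_belowI[of _ 0])
    with True show ?thesis unfolding first_explosion_def by (subst cInf_less_iff) auto
  next
    case False
    then show ?thesis by (simp add: first_explosion_def)
  qed
  show ?thesis
    by (rule borel_measurableI_less) (unfold *, measurable)
qed

text \<open>
  The image measure under a function that is not measurable is still given by the masses of preimages,
  or else is zero. As it is a probability here, the former holds. If the preimage of \<open>A\<close> were not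
  measurable, neither would be that of its complement, and both would get mass \<open>0\<close>.
\<close>
lemma distr_eq_pmf_imp_measurable:
  fixes f :: "'a \<Rightarrow> 'b" and p :: "'b pmf"
  assumes f: "distr M (count_space UNIV) f = measure_pmf p"
  shows "f \<in> measurable M (count_space UNIV)"
proof -
  have "sigma_sets UNIV UNIV = (UNIV :: 'b set set)" by (auto intro: sigma_sets.Basic)
  then have \<mu>: "emeasure (measure_pmf p) A = (if measure_space UNIV UNIV (\<lambda>A. emeasure M (f -` A \<inter> space M))
      then emeasure M (f -` A \<inter> space M) else 0)" for A
    unfolding f[symmetric] distr_def
    by (subst emeasure_measure_of_conv) simp
  have "emeasure (measure_pmf p) UNIV = 1" by simp
  then have *: "emeasure (measure_pmf p) A = emeasure M (f -` A \<inter> space M)" for A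
    using \<mu>[of A] \<mu>[of UNIV] by (simp split: if_splits)
  have "f -` A \<inter> space M \<in> sets M" for A
  proof (rule ccontr)
    assume A: "f -` A \<inter> space M \<notin> sets M"
    have "f -` A \<inter> space M = space M - (f -` (- A) \<inter> space M)" by auto
    with A have "f -` (- A) \<inter> space M \<notin> sets M" by (metis sets.compl_sets)
    with A have "emeasure (measure_pmf p) A = 0" "emeasure (measure_pmf p) (- A) = 0"
      by (simp_all add: * emeasure_notin_sets)
    moreover have "emeasure (measure_pmf p) A + emeasure (measure_pmf p) (- A) = emeasure (measure_pmf p) (A \<union> - A)"
      by (intro plus_emeasure) auto
    ultimately show False by simp
  qed
  then show ?thesis by (auto simp: measurable_def)
qed

section \<open>The steady state\<close>

locale steady_growth =
  fixes W :: "rgraph pmf"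
  assumes steady: "steady_state_law W"
begin

sublocale finite_mean_growth W
  using steady unfolding steady_state_law_def by unfold_locales (simp_all add: mean_explosion_def)

sublocale stationary: prob_space "stationary_law W"
  by (rule prob_space_stationary_law)

sublocale growth: prob_space "growth_law W"
  by (rule prob_space_growth_law)

lemma distr_stationary_process:
  "distr (stationary_law W) (count_space UNIV) (\<lambda>x. stationary_process x 0) = measure_pmf W"
  using steady unfolding steady_state_law_def by blast

lemma measurable_stationary_process [measurable]:
  "(\<lambda>x. stationary_process x 0) \<in> measurable (stationary_law W) (count_space UNIV)"
  by (rule distr_eq_pmf_imp_measurable[OF distr_stationary_process])

definition current_size :: "sample \<Rightarrow> nat" where
  "current_size x = num_vertices (stationary_process x 0)"

lemma measurable_current_size [measurable]: "current_size \<in> measurable (stationary_law W) (count_space UNIV)"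
  unfolding current_size_def by measurable

lemma current_size_neq_0 [simp]: "current_size x \<noteq> 0"
  using num_vertices_pos by (simp add: current_size_def)

lemma sets_current_size [measurable]: "{x. current_size x = k} \<in> sets (stationary_law W)"
  using measurable_sets[OF measurable_current_size, of "{k}"] by (simp add: vimage_def)

definition size_weight :: "nat \<Rightarrow> real" where
  "size_weight k = pmf (map_pmf num_vertices W) k"

lemma size_weight_nonneg [simp]: "0 \<le> size_weight k"
  by (simp add: size_weight_def)

lemma size_weight_0: "size_weight 0 = 0"
proof -
  have "0 \<notin> num_vertices ` set_pmf W" using num_vertices_pos by (metis imageE less_irrefl)
  then show ?thesis by (simp add: size_weight_def pmf_eq_0_set_pmf)
qed

lemma emeasure_current_size: "emeasure (stationary_law W) {x. current_size x = k} = ennreal (size_weight k)"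
proof -
  have "emeasure (stationary_law W) {x. current_size x = k} =
      emeasure (distr (stationary_law W) (count_space UNIV) (\<lambda>x. stationary_process x 0)) {H. num_vertices H = k}"
    by (subst emeasure_distr) (auto simp: current_size_def vimage_def)
  also have "\<dots> = emeasure (map_pmf num_vertices W) {k}"
    unfolding distr_stationary_process by (simp add: map_pmf_rep_eq emeasure_distr vimage_def)
  finally show ?thesis by (simp add: size_weight_def emeasure_pmf_single)
qed

lemma AE_stationary_explicit:
  "AE x in stationary_law W. \<exists>t. explosion_time (snd x 0) = ennreal t \<and> 0 < t \<and> 0 \<le> fst x \<and> fst x < 1 \<and>
     regular_path (snd x 0) \<and> first_explosion x = (1 - fst x) * t \<and>
     stationary_process x 0 = growth_process (snd x 0) (fst x * t)"
  using AE_stationary_law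
proof eventually_elim
  case (elim x)
  let ?t = "lifetime x 0"
  have "explosion_time (snd x 0) = ennreal ?t"
    using elim by (simp add: lifetime_def)
  moreover from this have "0 < ?t" using explosion_time_pos[of "snd x 0"] elim by simp
  ultimately show ?case using elim first_explosion_eq[of x] stationary_process_0[of x] by blast
qed

lemma AE_first_explosion_pos: "AE x in stationary_law W. 0 < first_explosion x"
  using AE_stationary_explicit by eventually_elim auto

text \<open>
  The first factor does not depend on \<open>h\<close>: the size at time \<open>0\<close> is \<open>k\<close> with that probability, and
  given this the residual lifetime is distributed as the explosion time from size \<open>k\<close>.
\<close>
lemma conditioned_integral_occupation:
  assumes h [measurable]: "h \<in> borel_measurable borel" and k: "0 < k"
  shows "(\<integral>\<^sup>+ x. (if current_size x = k then h (ennreal (first_explosion x)) else 0) \<partial>stationary_law W) =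
    (\<Sum>n. ennreal (hit_prob W n 1 k / real k)) / mean_explosion W *
      (\<integral>\<^sup>+ \<omega>. h (explosion_from k \<omega>) \<partial>growth_law W)"
proof -
  have "(\<integral>\<^sup>+ x. (if current_size x = k then h (ennreal (first_explosion x)) else 0) \<partial>stationary_law W) =
      (\<integral>\<^sup>+ x. observable h k (fst x) (snd x 0) \<partial>stationary_law W)"
  proof (rule nn_integral_cong_AE)
    from AE_stationary_explicit
    show "AE x in stationary_law W. (if current_size x = k then h (ennreal (first_explosion x)) else 0)
       = observable h k (fst x) (snd x 0)"
    proof eventually_elim
      case (elim x)
      then show ?case by (auto simp: observable_eq current_size_def)
    qed
  qed
  also have "\<dots> = (\<integral>\<^sup>+ \<omega>. explosion_time \<omega> * (\<integral>\<^sup>+ u. indicator {0..<1} u * observable h k u \<omega> \<partial>lborel) \<partial>growth_law W) / mean_explosion W"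
    by (rule stationary_integral) measurable
  also have "(\<integral>\<^sup>+ \<omega>. explosion_time \<omega> * (\<integral>\<^sup>+ u. indicator {0..<1} u * observable h k u \<omega> \<partial>lborel) \<partial>growth_law W)
     = (\<integral>\<^sup>+ \<omega>. (\<Sum>n. occupation h k n 1 \<omega>) \<partial>growth_law W)"
  proof (rule nn_integral_cong_AE)
    show "AE \<omega> in growth_law W. explosion_time \<omega> * (\<integral>\<^sup>+ u. indicator {0..<1} u * observable h k u \<omega> \<partial>lborel)
        = (\<Sum>n. occupation h k n 1 \<omega>)"
      using AE_regular_path explodes
    proof eventually_elim
      case (elim \<omega>)
      show ?case
        by (rule observable_integral[OF elim(1) _ enn2real_nonneg[of "explosion_time \<omega>"] h]) (use elim(2) in simp)
    qed
  qed
  also have "\<dots> = (\<Sum>n. \<integral>\<^sup>+ \<omega>. occupation h k n 1 \<omega> \<partial>growth_law W)"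
    by (rule nn_integral_suminf) measurable
  also have "\<dots> = (\<Sum>n. ennreal (hit_prob W n 1 k / real k)) * (\<integral>\<^sup>+ \<omega>. h (explosion_from k \<omega>) \<partial>growth_law W)"
    using k by (simp add: expected_occupation[OF h])
  finally show ?thesis by (simp add: divide_ennreal_def ac_simps)
qed

text \<open>
  Here the steady state enters: the size at time \<open>0\<close> has the same law as the increments.
\<close>
lemma size_weight_eq_occupation:
  assumes "0 < k"
  shows "ennreal (size_weight k) = (\<Sum>n. ennreal (hit_prob W n 1 k / real k)) / mean_explosion W"
proof -
  have "ennreal (size_weight k) = (\<integral>\<^sup>+ x. indicator {x. current_size x = k} x \<partial>stationary_law W)"
    by (subst nn_integral_indicator) (simp_all add: emeasure_current_size)
  also have "\<dots> = (\<integral>\<^sup>+ x. (if current_size x = k then (\<lambda>_. 1) (ennreal (first_explosion x)) else 0) \<partial>stationary_law W)"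
    by (intro nn_integral_cong) (simp add: indicator_def)
  also have "\<dots> = (\<Sum>n. ennreal (hit_prob W n 1 k / real k)) / mean_explosion W"
    using assms growth.emeasure_space_1 by (subst conditioned_integral_occupation) simp_all
  finally show ?thesis .
qed

lemma conditioned_integral:
  assumes h: "h \<in> borel_measurable borel" and k: "0 < k"
  shows "(\<integral>\<^sup>+ x. (if current_size x = k then h (ennreal (first_explosion x)) else 0) \<partial>stationary_law W) =
    ennreal (size_weight k) * (\<integral>\<^sup>+ \<omega>. h (explosion_from k \<omega>) \<partial>growth_law W)"
  unfolding conditioned_integral_occupation[OF assms] size_weight_eq_occupation[OF k] ..

lemma total_integral:
  assumes [measurable]: "h \<in> borel_measurable borel"
  shows "(\<integral>\<^sup>+ x. h (ennreal (first_explosion x)) \<partial>stationary_law W) =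
    (\<Sum>k. ennreal (size_weight k) * (\<integral>\<^sup>+ \<omega>. h (explosion_from k \<omega>) \<partial>growth_law W))"
proof -
  have "(\<integral>\<^sup>+ x. h (ennreal (first_explosion x)) \<partial>stationary_law W) =
     (\<integral>\<^sup>+ x. (\<Sum>k. if current_size x = k then h (ennreal (first_explosion x)) else 0) \<partial>stationary_law W)"
  proof (rule nn_integral_cong)
    show "h (ennreal (first_explosion x)) = (\<Sum>k. if current_size x = k then h (ennreal (first_explosion x)) else 0)" for x
      by (subst suminf_finite[of "{current_size x}"]) auto
  qed
  also have "\<dots> = (\<Sum>k. \<integral>\<^sup>+ x. (if current_size x = k then h (ennreal (first_explosion x)) else 0) \<partial>stationary_law W)"
    by (intro nn_integral_suminf) measurable
  also have "\<dots> = (\<Sum>k. ennreal (size_weight k) * (\<integral>\<^sup>+ \<omega>. h (explosion_from k \<omega>) \<partial>growth_law W))"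
  proof (rule suminf_cong)
    fix k
    show "(\<integral>\<^sup>+ x. (if current_size x = k then h (ennreal (first_explosion x)) else 0) \<partial>stationary_law W) =
      ennreal (size_weight k) * (\<integral>\<^sup>+ \<omega>. h (explosion_from k \<omega>) \<partial>growth_law W)"
      by (cases "k = 0") (simp_all add: size_weight_0 conditioned_integral)
  qed
  finally show ?thesis .
qed

lemma AE_explosion_time_eq: "AE \<omega> in growth_law W. explosion_time \<omega> = explosion_from 1 \<omega>"
  using AE_regular_path by eventually_elim (rule explosion_time_eq)

text \<open>
  As in any stationary renewal process, the residual lifetime has density \<open>P(T \<ge> y) / m\<close>.
\<close>
lemma residual_lifetime_integral:
  assumes [measurable]: "h \<in> borel_measurable borel"
  shows "(\<integral>\<^sup>+ x. h (ennreal (first_explosion x)) \<partial>stationary_law W) =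
    (\<integral>\<^sup>+ y. indicator {0<..} y * h (ennreal y) * (\<integral>\<^sup>+ \<omega>. indicator {ennreal y..} (explosion_from 1 \<omega>) \<partial>growth_law W) \<partial>lborel)
      / mean_explosion W"
proof -
  let ?F = "\<lambda>u \<omega>. h (ennreal (1 - u) * explosion_time \<omega>)"
  have "(\<integral>\<^sup>+ x. h (ennreal (first_explosion x)) \<partial>stationary_law W) = (\<integral>\<^sup>+ x. ?F (fst x) (snd x 0) \<partial>stationary_law W)"
  proof (rule nn_integral_cong_AE)
    from AE_stationary_explicit
    show "AE x in stationary_law W. h (ennreal (first_explosion x)) = ?F (fst x) (snd x 0)"
      by eventually_elim (auto simp: ennreal_mult)
  qed
  also have "\<dots> = (\<integral>\<^sup>+ \<omega>. explosion_time \<omega> * (\<integral>\<^sup>+ u. indicator {0..<1} u * ?F u \<omega> \<partial>lborel) \<partial>growth_law W) / mean_explosion W"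
    by (rule stationary_integral) measurable
  also have "(\<integral>\<^sup>+ \<omega>. explosion_time \<omega> * (\<integral>\<^sup>+ u. indicator {0..<1} u * ?F u \<omega> \<partial>lborel) \<partial>growth_law W)
     = (\<integral>\<^sup>+ \<omega>. \<integral>\<^sup>+ y. indicator {0<..} y * h (ennreal y) * indicator {ennreal y..} (explosion_from 1 \<omega>) \<partial>lborel \<partial>growth_law W)"
  proof (rule nn_integral_cong_AE)
    show "AE \<omega> in growth_law W. explosion_time \<omega> * (\<integral>\<^sup>+ u. indicator {0..<1} u * ?F u \<omega> \<partial>lborel) =
        (\<integral>\<^sup>+ y. indicator {0<..} y * h (ennreal y) * indicator {ennreal y..} (explosion_from 1 \<omega>) \<partial>lborel)"
      using AE_regular_path explodes
    proof eventually_elim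
      case (elim \<omega>)
      then obtain t where t: "explosion_time \<omega> = ennreal t" "0 \<le> t" by (cases "explosion_time \<omega>") auto
      have t0: "0 < t" using explosion_time_pos[OF elim(1)] t by simp
      have "(\<integral>\<^sup>+ u. indicator {0..<1} u * ?F u \<omega> \<partial>lborel) = (\<integral>\<^sup>+ u. indicator {0..<1} u * h (ennreal ((1 - u) * t)) \<partial>lborel)"
        using t by (intro nn_integral_cong) (auto simp: ennreal_mult split: split_indicator)
      then show ?case using uniform_position_integral[OF t0 assms] t explosion_time_eq[OF elim(1)] by simp
    qed
  qed
  also have "\<dots> = (\<integral>\<^sup>+ y. indicator {0<..} y * h (ennreal y) * (\<integral>\<^sup>+ \<omega>. indicator {ennreal y..} (explosion_from 1 \<omega>) \<partial>growth_law W) \<partial>lborel)"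
    by (intro nn_integral_layer_cake growth.sigma_finite_measure_axioms) measurable
  finally show ?thesis .
qed

lemma self_consistent: "self_consistent_weights size_weight (enn2real (mean_explosion W))"
proof
  show "0 \<le> size_weight k" for k by simp
  show "size_weight 0 = 0" by (rule size_weight_0)
  have "(\<Sum>j. ennreal (size_weight j)) = (\<integral>\<^sup>+ j. 1 \<partial>map_pmf num_vertices W)"
    unfolding nn_integral_pmf_eq_suminf size_weight_def by simp
  also have "\<dots> = ennreal 1"
    using measure_pmf.emeasure_space_1[of "map_pmf num_vertices W"] by (simp only: nn_integral_const) simp
  finally have "(\<Sum>j. ennreal (size_weight j)) = ennreal 1" .
  with summable_sums[OF summableI, of "\<lambda>j. ennreal (size_weight j)"]
  have "(\<lambda>j. ennreal (size_weight j)) sums ennreal 1" by (rule subst[rotated])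
  then show "size_weight sums 1"
    by (subst (asm) sums_ennreal) simp_all
  show "0 < enn2real (mean_explosion W)"
    using mean_finite mean_explosion_neq_0 by (simp add: enn2real_positive_iff zero_less_iff_neq_zero)
  fix k
  let ?m = "mean_explosion W" and ?V = "Abs_fps size_weight"
  have hit: "hit_prob W n 1 (Suc k) = fps_nth (?V ^ n) k" for n
    by (simp add: hit_prob_def size_weight_def[abs_def])
  have nn: "0 \<le> fps_nth (?V ^ n) k" for n using hit_prob_nonneg[of W n 1 "Suc k"] by (simp add: hit)
  have "ennreal (size_weight (Suc k)) = (\<Sum>n. ennreal (fps_nth (?V ^ n) k / real (Suc k))) / ?m"
    unfolding size_weight_eq_occupation[OF zero_less_Suc] hit ..
  also have "(\<Sum>n. ennreal (fps_nth (?V ^ n) k / real (Suc k))) = (\<Sum>n\<le>k. ennreal (fps_nth (?V ^ n) k / real (Suc k)))"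
    by (rule suminf_finite) (auto simp: startsby_zero_power_prefix size_weight_0)
  also have "\<dots> = ennreal ((\<Sum>n\<le>k. fps_nth (?V ^ n) k) / real (Suc k))"
    by (subst sum_ennreal) (simp_all add: nn sum_divide_distrib)
  also have "?m = ennreal (enn2real ?m)" using mean_finite by simp
  finally have "size_weight (Suc k) = (\<Sum>n\<le>k. fps_nth (?V ^ n) k) / real (Suc k) / enn2real ?m"
    using \<open>0 < enn2real ?m\<close> by (subst (asm) divide_ennreal) (simp_all add: nn sum_nonneg)
  then show "enn2real ?m * (real (Suc k) * size_weight (Suc k)) = (\<Sum>n\<le>k. fps_nth (?V ^ n) k)"
    using \<open>0 < enn2real ?m\<close> by (simp del: of_nat_Suc)
qed

sublocale self_consistent_weights size_weight "enn2real (mean_explosion W)"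
  by (rule self_consistent)

lemma mean_explosion_eq_2: "mean_explosion W = 2"
proof -
  have "mean_explosion W = ennreal (enn2real (mean_explosion W))" using mean_finite by simp
  then show ?thesis by (simp add: m_eq_2)
qed

lemma size_generating_function:
  assumes "0 \<le> z" "z \<le> 1"
  shows "(\<integral>\<^sup>+ j. ennreal (z ^ j) \<partial>map_pmf num_vertices W) = ennreal (1 - sqrt (1 - z))"
proof -
  have "(\<integral>\<^sup>+ j. ennreal (z ^ j) \<partial>map_pmf num_vertices W) = (\<Sum>j. ennreal (size_weight j * z ^ j))"
    unfolding nn_integral_pmf_eq_suminf using assms by (simp add: size_weight_def ennreal_mult)
  also have "\<dots> = ennreal (1 - sqrt (1 - z))"
    using generating_function[OF assms] assms by (intro suminf_ennreal_eq) auto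
  finally show ?thesis .
qed

text \<open>
  Closed tails \<open>{ennreal x..}\<close> are complementary to the events that an explosion occurs before \<open>x\<close>.
\<close>
definition survival :: "nat \<Rightarrow> real \<Rightarrow> ennreal" where
  "survival k x = (\<integral>\<^sup>+ \<omega>. indicator {ennreal x..} (explosion_from k \<omega>) \<partial>growth_law W)"

lemma survival_le: "0 \<le> x \<Longrightarrow> 0 < k \<Longrightarrow> survival k x \<le> ennreal (1 / cosh (x / 2) ^ (2 * k))"
  unfolding survival_def by (rule explosion_from_tail_bound[OF size_generating_function])

lemma measurable_survival [measurable]: "survival k \<in> borel_measurable borel"
  unfolding survival_def atLeast_iff indicator_def by measurable

lemma nn_integral_explosion_from:
  "(\<integral>\<^sup>+ \<omega>. explosion_from k \<omega> \<partial>growth_law W) = (\<integral>\<^sup>+ y. indicator {0<..} y * survival k y \<partial>lborel)"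
  unfolding survival_def by (intro nn_integral_eq_tail_integral growth.sigma_finite_measure_axioms) measurable

lemma size_mixture_sech:
  assumes "0 \<le> x"
  shows "(\<Sum>k. ennreal (size_weight k) * ennreal (1 / cosh (x / 2) ^ (2 * k))) = ennreal (1 - tanh (x / 2))"
  using sech_power_mixture[OF size_generating_function assms, of 0]
  unfolding nn_integral_pmf_eq_suminf by (simp add: size_weight_def)

text \<open>
  The mean explosion time \<open>2\<close> is the integral of \<open>survival 1\<close>, of which the part before \<open>x\<close> is at most
  \<open>2 tanh (x / 2)\<close>; half of the rest is the probability that the residual lifetime reaches \<open>x\<close>.
\<close>
lemma size_mixture_survival_ge:
  assumes x: "0 \<le> x"
  shows "ennreal (1 - tanh (x / 2)) \<le> (\<Sum>k. ennreal (size_weight k) * survival k x)"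
proof -
  let ?J = "\<integral>\<^sup>+ y. indicator {0<..} y * indicator {ennreal x..} (ennreal y) * survival 1 y \<partial>lborel"
  have "2 = (\<integral>\<^sup>+ \<omega>. explosion_from 1 \<omega> \<partial>growth_law W)"
    unfolding mean_explosion_eq_2[symmetric] mean_explosion_def
    by (rule nn_integral_cong_AE) (rule AE_explosion_time_eq)
  also have "\<dots> \<le> (\<integral>\<^sup>+ y. ennreal (1 / cosh (y / 2) ^ 2) * indicator {0..x} y
      + indicator {0<..} y * indicator {ennreal x..} (ennreal y) * survival 1 y \<partial>lborel)"
    unfolding nn_integral_explosion_from
  proof (rule nn_integral_mono)
    fix y :: real
    show "indicator {0<..} y * survival 1 y \<le> ennreal (1 / cosh (y / 2) ^ 2) * indicator {0..x} y
      + indicator {0<..} y * indicator {ennreal x..} (ennreal y) * survival 1 y"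
      using survival_le[of y 1] x by (cases "0 < y"; cases "x \<le> y") (auto simp: indicator_def)
  qed
  also have "\<dots> = ennreal (2 * tanh (x / 2)) + ?J"
  proof -
    have "continuous_on UNIV (\<lambda>y::real. 1 / cosh (y / 2) ^ 2)"
      by (intro continuous_intros) auto
    then have [measurable]: "(\<lambda>y::real. 1 / cosh (y / 2) ^ 2) \<in> borel_measurable borel"
      by (rule borel_measurable_continuous_onI)
    show ?thesis
      unfolding nn_integral_sech_squared_Icc[OF x, symmetric]
      by (rule nn_integral_add) measurable
  qed
  finally have J: "2 \<le> ennreal (2 * tanh (x / 2)) + ?J" .
  have t: "0 \<le> tanh (x / 2)" "tanh (x / 2) < 1" using x tanh_real_lt_1 by auto
  have "ennreal (1 - tanh (x / 2)) \<le> ?J / 2"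
  proof (cases ?J)
    case (real j)
    have "2 \<le> 2 * tanh (x / 2) + j"
      using J t real by (simp flip: ennreal_plus ennreal_numeral)
    then have "1 - tanh (x / 2) \<le> j / 2" by simp
    moreover have "?J / 2 = ennreal (j / 2)" using real divide_ennreal[of j 2] by simp
    ultimately show ?thesis by (simp only: ennreal_leI)
  qed (simp add: ennreal_top_divide)
  also have "?J / 2 = (\<integral>\<^sup>+ x'. indicator {ennreal x..} (ennreal (first_explosion x')) \<partial>stationary_law W)"
    unfolding survival_def mean_explosion_eq_2[symmetric]
    by (rule residual_lifetime_integral[symmetric]) measurable
  also have "\<dots> = (\<Sum>k. ennreal (size_weight k) * survival k x)"
    unfolding survival_def by (rule total_integral) measurable
  finally show ?thesis .
qed

text \<open>
  Averaged over the sizes, the upper bound \<open>survival_le\<close> equals the lower bound just obtained, so the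
  differences, weighted by the positive weights, sum to \<open>0\<close>.
\<close>
lemma survival_eq:
  assumes x: "0 \<le> x" and k: "0 < k"
  shows "survival k x = ennreal (1 / cosh (x / 2) ^ (2 * k))"
proof -
  let ?G = "\<lambda>k. ennreal (1 / cosh (x / 2) ^ (2 * k))"
  let ?d = "\<lambda>k. ennreal (size_weight k) * (?G k - survival k x)"
  have split: "ennreal (size_weight j) * ?G j = ennreal (size_weight j) * survival j x + ?d j" for j
  proof (cases "j = 0")
    case False
    then show ?thesis using survival_le[OF x, of j] by (simp add: distrib_left[symmetric] add_diff_inverse_ennreal)
  qed (simp add: size_weight_0)
  have "ennreal (1 - tanh (x / 2)) = (\<Sum>j. ennreal (size_weight j) * survival j x + ?d j)"
    unfolding split[symmetric] by (rule size_mixture_sech[OF x, symmetric])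
  also have "\<dots> = (\<Sum>j. ennreal (size_weight j) * survival j x) + (\<Sum>j. ?d j)"
    by (intro suminf_add[symmetric]) auto
  also have "\<dots> \<ge> ennreal (1 - tanh (x / 2)) + (\<Sum>j. ?d j)"
    by (intro add_right_mono size_mixture_survival_ge x)
  finally have "(\<Sum>j. ?d j) = 0"
    by (cases "\<Sum>j. ?d j") (auto simp flip: ennreal_plus simp: top_unique)
  then have "?d k = 0" by (simp add: suminf_eq_zero_iff)
  moreover have "0 < size_weight k" using weight_pos[of "k - 1"] k by simp
  ultimately have "?G k - survival k x = 0" by simp
  then have "?G k \<le> survival k x" by (simp add: diff_eq_0_iff_ennreal)
  with survival_le[OF x k] show ?thesis by (rule antisym)
qed

section \<open>Laws and means of the explosion times\<close>

lemma sets_tail: "{\<omega>. x \<le> first_explosion \<omega> \<and> current_size \<omega> = k} \<in> sets (stationary_law W)"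
proof -
  have "Measurable.pred (stationary_law W) (\<lambda>\<omega>. x \<le> first_explosion \<omega> \<and> current_size \<omega> = k)" by measurable
  then show ?thesis by (simp add: pred_def)
qed

lemma emeasure_conditioned_tail:
  assumes x: "0 \<le> x" and k: "0 < k"
  shows "emeasure (stationary_law W) {\<omega>. x \<le> first_explosion \<omega> \<and> current_size \<omega> = k} =
    ennreal (size_weight k / cosh (x / 2) ^ (2 * k))"
proof -
  have "emeasure (stationary_law W) {\<omega>. x \<le> first_explosion \<omega> \<and> current_size \<omega> = k} =
    (\<integral>\<^sup>+ \<omega>. indicator {\<omega>. x \<le> first_explosion \<omega> \<and> current_size \<omega> = k} \<omega> \<partial>stationary_law W)"
    by (rule nn_integral_indicator[symmetric]) (use sets_tail in simp)
  also have "\<dots> = (\<integral>\<^sup>+ \<omega>. (if current_size \<omega> = k then indicator {ennreal x..} (ennreal (first_explosion \<omega>)) else 0)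
      \<partial>stationary_law W)"
    by (rule nn_integral_cong_AE, use AE_first_explosion_pos in eventually_elim)
       (auto simp: indicator_def)
  also have "\<dots> = ennreal (size_weight k) * survival k x"
    unfolding survival_def by (intro conditioned_integral k) measurable
  finally show ?thesis using survival_eq[OF x k] by (simp flip: ennreal_mult)
qed

lemma conditioned_first_explosion_cdf:
  assumes x: "0 \<le> x" and k: "1 \<le> k"
  shows "\<P>(\<omega> in stationary_law W. first_explosion \<omega> < x \<bar> num_vertices (stationary_process \<omega> 0) = k)
     = 1 - 1 / cosh (x / 2) ^ (2 * k)"
proof -
  have w: "0 < size_weight k" using weight_pos[of "k - 1"] k by simp
  let ?A = "{\<omega>. current_size \<omega> = k}" and ?B = "{\<omega>. x \<le> first_explosion \<omega> \<and> current_size \<omega> = k}"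
  have A: "stationary.prob ?A = size_weight k"
    by (simp add: measure_def emeasure_current_size)
  have B: "stationary.prob ?B = size_weight k / cosh (x / 2) ^ (2 * k)"
    using x k w by (simp add: measure_def emeasure_conditioned_tail)
  have "stationary.prob {\<omega>. first_explosion \<omega> < x \<and> current_size \<omega> = k} = stationary.prob (?A - ?B)"
    by (rule arg_cong[where f = stationary.prob]) auto
  also have "\<dots> = stationary.prob ?A - stationary.prob ?B"
    by (rule stationary.finite_measure_Diff) (use sets_tail in auto)
  finally show ?thesis
    using w by (simp add: cond_prob_def current_size_def[symmetric] A B field_simps)
qed

lemma explosion_time_cdf:
  assumes x: "0 \<le> x"
  shows "\<P>(\<omega> in growth_law W. explosion_time \<omega> < ennreal x) = (tanh (x / 2))\<^sup>2"
proof -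
  have [measurable]: "Measurable.pred (growth_law W) (\<lambda>\<omega>. ennreal x \<le> explosion_time \<omega>)" by measurable
  then have sets: "{\<omega>. ennreal x \<le> explosion_time \<omega>} \<in> sets (growth_law W)"
    by (simp add: pred_def)
  have "emeasure (growth_law W) {\<omega>. ennreal x \<le> explosion_time \<omega>} =
    (\<integral>\<^sup>+ \<omega>. indicator {\<omega>. ennreal x \<le> explosion_time \<omega>} \<omega> \<partial>growth_law W)"
    by (rule nn_integral_indicator[symmetric]) (rule sets)
  also have "\<dots> = survival 1 x"
    unfolding survival_def
    by (rule nn_integral_cong_AE, use AE_explosion_time_eq in eventually_elim) (simp add: indicator_def)
  also have "\<dots> = ennreal (1 / cosh (x / 2) ^ 2)" using survival_eq[OF x, of 1] by simp
  finally have "growth.prob {\<omega>. ennreal x \<le> explosion_time \<omega>} = 1 / cosh (x / 2) ^ 2"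
    by (simp add: measure_def)
  moreover have "\<P>(\<omega> in growth_law W. explosion_time \<omega> < ennreal x) =
      1 - growth.prob {\<omega>. ennreal x \<le> explosion_time \<omega>}"
    using growth.prob_compl[OF sets] by (simp add: not_le set_diff_eq)
  ultimately show ?thesis by (simp add: inverse_cosh_squared)
qed

lemma first_explosion_tail:
  assumes x: "0 \<le> x"
  shows "(\<integral>\<^sup>+ \<omega>. indicator {ennreal x..} (ennreal (first_explosion \<omega>)) \<partial>stationary_law W) = ennreal (1 - tanh (x / 2))"
proof -
  have "(\<integral>\<^sup>+ \<omega>. indicator {ennreal x..} (ennreal (first_explosion \<omega>)) \<partial>stationary_law W)
    = (\<Sum>k. ennreal (size_weight k) * survival k x)"
    unfolding survival_def by (intro total_integral) measurable
  also have "\<dots> = (\<Sum>k. ennreal (size_weight k) * ennreal (1 / cosh (x / 2) ^ (2 * k)))"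
  proof (rule suminf_cong)
    show "ennreal (size_weight k) * survival k x = ennreal (size_weight k) * ennreal (1 / cosh (x / 2) ^ (2 * k))" for k
      by (cases "k = 0") (simp_all add: size_weight_0 survival_eq[OF x])
  qed
  finally show ?thesis by (simp only: size_mixture_sech[OF x])
qed

lemma first_explosion_cdf:
  assumes x: "0 \<le> x"
  shows "\<P>(\<omega> in stationary_law W. first_explosion \<omega> < x) = tanh (x / 2)"
proof -
  have t: "tanh (x / 2) < 1" by (rule tanh_real_lt_1)
  have "Measurable.pred (stationary_law W) (\<lambda>\<omega>. x \<le> first_explosion \<omega>)" by measurable
  then have sets: "{\<omega>. x \<le> first_explosion \<omega>} \<in> sets (stationary_law W)" by (simp add: pred_def)
  have "emeasure (stationary_law W) {\<omega>. x \<le> first_explosion \<omega>} =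
    (\<integral>\<^sup>+ \<omega>. indicator {\<omega>. x \<le> first_explosion \<omega>} \<omega> \<partial>stationary_law W)"
    by (rule nn_integral_indicator[symmetric]) (rule sets)
  also have "\<dots> = (\<integral>\<^sup>+ \<omega>. indicator {ennreal x..} (ennreal (first_explosion \<omega>)) \<partial>stationary_law W)"
    by (rule nn_integral_cong_AE, use AE_first_explosion_pos in eventually_elim) (auto simp: indicator_def)
  finally have "stationary.prob {\<omega>. x \<le> first_explosion \<omega>} = 1 - tanh (x / 2)"
    using t by (simp add: measure_def first_explosion_tail[OF x])
  moreover have "\<P>(\<omega> in stationary_law W. first_explosion \<omega> < x) = 1 - stationary.prob {\<omega>. x \<le> first_explosion \<omega>}"
    using stationary.prob_compl[OF sets] by (simp add: not_le set_diff_eq)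
  ultimately show ?thesis by simp
qed

lemma expectation_first_explosion: "has_bochner_integral (stationary_law W) first_explosion (2 * ln 2)"
proof (rule has_bochner_integral_nn_integral)
  show "AE \<omega> in stationary_law W. 0 \<le> first_explosion \<omega>"
    using AE_first_explosion_pos by eventually_elim simp
  have "(\<integral>\<^sup>+ \<omega>. ennreal (first_explosion \<omega>) \<partial>stationary_law W) =
    (\<integral>\<^sup>+ y. indicator {0<..} y * (\<integral>\<^sup>+ \<omega>. indicator {ennreal y..} (ennreal (first_explosion \<omega>)) \<partial>stationary_law W) \<partial>lborel)"
    by (intro nn_integral_eq_tail_integral stationary.sigma_finite_measure_axioms) measurable
  also have "\<dots> = (\<integral>\<^sup>+ y. ennreal (1 - tanh (y / 2)) * indicator {0..} y \<partial>lborel)"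
    unfolding nn_integral_Ioi_eq_Ici
    by (intro nn_integral_cong) (simp add: first_explosion_tail split: split_indicator)
  also have "\<dots> = ennreal (2 * ln 2)" by (rule nn_integral_one_minus_tanh)
  finally show "(\<integral>\<^sup>+ \<omega>. ennreal (first_explosion \<omega>) \<partial>stationary_law W) = ennreal (2 * ln 2)" .
qed simp_all

lemma nn_integral_explosion_from_eq:
  assumes k: "0 < k"
  shows "(\<integral>\<^sup>+ \<omega>. explosion_from k \<omega> \<partial>growth_law W) = ennreal (4 ^ k / (real k * real ((2 * k) choose k)))"
proof -
  have "(\<integral>\<^sup>+ \<omega>. explosion_from k \<omega> \<partial>growth_law W) =
      (\<integral>\<^sup>+ y. ennreal (1 / cosh (y / 2) ^ (2 * k)) * indicator {0..} y \<partial>lborel)"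
    unfolding nn_integral_explosion_from nn_integral_Ioi_eq_Ici
    using k by (intro nn_integral_cong) (simp add: survival_eq split: split_indicator)
  then show ?thesis by (simp only: nn_integral_sech_power[OF k])
qed

lemma conditional_expectation_first_explosion:
  assumes k: "1 \<le> k"
  shows "has_bochner_integral
            (uniform_measure (stationary_law W)
              {\<omega> \<in> space (stationary_law W). num_vertices (stationary_process \<omega> 0) = k})
            first_explosion (4 ^ k / (real k * real ((2 * k) choose k)))"
proof -
  have w: "0 < size_weight k" using weight_pos[of "k - 1"] k by simp
  have A: "{\<omega> \<in> space (stationary_law W). num_vertices (stationary_process \<omega> 0) = k} = {\<omega>. current_size \<omega> = k}"
    by (simp add: current_size_def)
  show ?thesis unfolding A
  proof (rule has_bochner_integral_nn_integral)
    show "AE \<omega> in uniform_measure (stationary_law W) {\<omega>. current_size \<omega> = k}. 0 \<le> first_explosion \<omega>"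
      by (rule AE_uniform_measureI[OF sets_current_size], use AE_first_explosion_pos in eventually_elim) simp
    have "(\<integral>\<^sup>+ \<omega>. ennreal (first_explosion \<omega>) \<partial>uniform_measure (stationary_law W) {\<omega>. current_size \<omega> = k}) =
      (\<integral>\<^sup>+ \<omega>. ennreal (first_explosion \<omega>) * indicator {\<omega>. current_size \<omega> = k} \<omega> \<partial>stationary_law W) / ennreal (size_weight k)"
      by (subst nn_integral_uniform_measure) (simp_all add: emeasure_current_size)
    also have "(\<integral>\<^sup>+ \<omega>. ennreal (first_explosion \<omega>) * indicator {\<omega>. current_size \<omega> = k} \<omega> \<partial>stationary_law W) =
      (\<integral>\<^sup>+ \<omega>. (if current_size \<omega> = k then (\<lambda>y. y) (ennreal (first_explosion \<omega>)) else 0) \<partial>stationary_law W)"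
      by (intro nn_integral_cong) (simp add: indicator_def)
    also have "\<dots> = ennreal (size_weight k) * (\<integral>\<^sup>+ \<omega>. explosion_from k \<omega> \<partial>growth_law W)"
      using k by (intro conditioned_integral) auto
    also have "\<dots> / ennreal (size_weight k) = (\<integral>\<^sup>+ \<omega>. explosion_from k \<omega> \<partial>growth_law W)"
      using w by (simp add: nn_integral_explosion_from_eq mult.commute[of "ennreal _"] ennreal_mult_divide_eq)
    also have "\<dots> = ennreal (4 ^ k / (real k * real ((2 * k) choose k)))"
      using k by (intro nn_integral_explosion_from_eq) simp
    finally show "(\<integral>\<^sup>+ \<omega>. ennreal (first_explosion \<omega>) \<partial>uniform_measure (stationary_law W) {\<omega>. current_size \<omega> = k}) =
       ennreal (4 ^ k / (real k * real ((2 * k) choose k)))" .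
  qed simp_all
qed

end

theorem lemma8:
  fixes W :: "rgraph pmf"
  assumes "steady_state_law W"
  shows "(\<forall>(x::real) (k::nat). 0 \<le> x \<longrightarrow> 1 \<le> k \<longrightarrow>
            \<P>(\<omega> in stationary_law W. first_explosion \<omega> < x
                \<bar> num_vertices (stationary_process \<omega> 0) = k) = 1 - 1 / cosh (x / 2) ^ (2 * k)) \<and>
         (\<forall>x\<ge>0. \<P>(\<omega> in growth_law W. explosion_time \<omega> < ennreal x) = (tanh (x / 2))\<^sup>2) \<and>
         (\<forall>x\<ge>0. \<P>(\<omega> in stationary_law W. first_explosion \<omega> < x) = tanh (x / 2)) \<and>
         has_bochner_integral (stationary_law W) first_explosion (2 * ln 2) \<and>
         (\<forall>k\<ge>1. has_bochner_integral
            (uniform_measure (stationary_law W)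
              {\<omega> \<in> space (stationary_law W). num_vertices (stationary_process \<omega> 0) = k})
            first_explosion (4 ^ k / (real k * real ((2 * k) choose k))))"
proof -
  interpret steady_growth W by unfold_locales (fact assms)
  show ?thesis
    using conditioned_first_explosion_cdf explosion_time_cdf first_explosion_cdf
      expectation_first_explosion conditional_expectation_first_explosion
    by blast
qed

end
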